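(* Let $R$ and $B$ be two independent random $n$-element submultisets of the leaves of a balanced HST $H(b,\delta,\lambda)$, and let $h=\min(\delta,\log_b n)$. Then the expected cost of the bichromatic minimum spanning tree on $R$ and $B$ is \[\Theta\Big(\sum_{i=1}^{h}(b\lambda)^i\Big),\] where the implied constants depend only on $b$ and $\lambda$.
   Context: A balanced HST $H(b,\delta,\lambda)$ (integers $b\ge2$, $\delta\ge1$, real $0<\lambda<1$) is a rooted tree in which every non-leaf vertex has exactly $b$ children and every leaf is at depth $\delta$; the root is at level $0$, and each edge joining a vertex at level $\ell-1$ to a child at level $\ell$ has weight $\lambda^\ell$. The distance $d_H(x,y)$ is the total weight of the tree path between $x$ and $y$. A random $n$-element submultiset of the leaves is obtained by choosing $n$ leaves independently and uniformly at random (repetitions allowed); copies of the same leaf are treated as distinct points at distance $0$. The bichromatic MST cost is the minimum total $d_H$-weight of a spanning tree of the complete bipartite graph with colour classes $R$ (red) and $B$ (blue), i.e. a spanning tree all of whose edges join a red point to a blue point. The sum ranges over integers $i$ with $1\le i\le h$.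
   Formalization: The formal statement assumes n ≥ b (that is, h ≥ 1): for 1 ≤ n < b the sum is empty and equals 0, while the expected cost of the bichromatic minimum spanning tree is positive, so the claimed Θ bound fails there. *)

theory Defs
  imports "HOL-Probability.Probability" "HOL-Probability.Product_PMF"
begin

section \<open>Paths, cycles and trees in simple undirected graphs\<close>

text \<open>
  Graphs are given by a set of two-element edges; paths are the lists of their vertices,
  and a single vertex is a path. A cycle is listed without repeating its first vertex.
  (The trees of the AFP entry Graph\_Theory are not suitable here: that notion only excludes
  directed cycles, and reads a pair of opposite arcs as a cycle.)
\<close>

definition is_path :: "'v set set \<Rightarrow> 'v list \<Rightarrow> bool" where
  "is_path E p \<longleftrightarrow>
     p \<noteq> [] \<and> distinct p \<and> (\<forall>i. Suc i < length p \<longrightarrow> {p ! i, p ! Suc i} \<in> E)"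

definition path_between :: "'v set set \<Rightarrow> 'v \<Rightarrow> 'v list \<Rightarrow> 'v \<Rightarrow> bool" where
  "path_between E x p y \<longleftrightarrow> is_path E p \<and> hd p = x \<and> last p = y"

definition is_cycle :: "'v set set \<Rightarrow> 'v list \<Rightarrow> bool" where
  "is_cycle E p \<longleftrightarrow> is_path E p \<and> length p \<ge> 3 \<and> {last p, hd p} \<in> E"

definition is_tree :: "'v set \<Rightarrow> 'v set set \<Rightarrow> bool" where
  "is_tree V E \<longleftrightarrow>
     V \<noteq> {} \<and> E \<subseteq> {{u, v} | u v. u \<in> V \<and> v \<in> V \<and> u \<noteq> v} \<and>
     (\<forall>u\<in>V. \<forall>v\<in>V. \<exists>p. path_between E u p v) \<and>
     (\<nexists>p. is_cycle E p)"

definition path_weight :: "('v \<Rightarrow> 'v \<Rightarrow> real) \<Rightarrow> 'v list \<Rightarrow> real" where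
  "path_weight w p = (\<Sum>i<length p - 1. w (p ! i) (p ! Suc i))"

text \<open>Meaningful when \<open>x\<close> and \<open>y\<close> are vertices of a tree, where the path is unique.\<close>

definition tree_dist :: "'v set set \<Rightarrow> ('v \<Rightarrow> 'v \<Rightarrow> real) \<Rightarrow> 'v \<Rightarrow> 'v \<Rightarrow> real" where
  "tree_dist E w x y = path_weight w (THE p. path_between E x p y)"


section \<open>The balanced HST\<close>

text \<open>
  A vertex is identified with the list of child indices leading to it from the root \<open>[]\<close>,
  so its level is the length of the list.
\<close>

definition hst_leaves :: "nat \<Rightarrow> nat \<Rightarrow> nat list set" where
  "hst_leaves b \<delta> = {v. set v \<subseteq> {..<b} \<and> length v = \<delta>}"

definition hst_edges :: "nat \<Rightarrow> nat \<Rightarrow> nat list set set" where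
  "hst_edges b \<delta> = {{v, v @ [c]} | v c. set v \<subseteq> {..<b} \<and> length v < \<delta> \<and> c < b}"

text \<open>The maximum is the level of the lower endpoint of the edge.\<close>

definition hst_weight :: "real \<Rightarrow> nat list \<Rightarrow> nat list \<Rightarrow> real" where
  "hst_weight lam u v = lam ^ max (length u) (length v)"

definition hst_dist :: "nat \<Rightarrow> nat \<Rightarrow> real \<Rightarrow> nat list \<Rightarrow> nat list \<Rightarrow> real" where
  "hst_dist b \<delta> lam = tree_dist (hst_edges b \<delta>) (hst_weight lam)"


section \<open>Bichromatic minimum spanning trees of random submultisets\<close>

text \<open>
  An \<open>n\<close>-element multiset of points is given by a family indexed by \<open>{..<n}\<close>, so that copies of
  a point stay distinct. The red and blue points are the vertices \<open>Inl i\<close> and \<open>Inr j\<close>, and a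
  set \<open>T\<close> of index pairs stands for the set of edges joining \<open>Inl i\<close> to \<open>Inr j\<close>, \<open>(i, j) \<in> T\<close>.
\<close>

definition bichromatic_edges :: "(nat \<times> nat) set \<Rightarrow> (nat + nat) set set" where
  "bichromatic_edges T = (\<lambda>(i, j). {Inl i, Inr j}) ` T"

definition bichromatic_spanning_tree :: "nat \<Rightarrow> (nat \<times> nat) set \<Rightarrow> bool" where
  "bichromatic_spanning_tree n T \<longleftrightarrow>
     T \<subseteq> {..<n} \<times> {..<n} \<and> is_tree ({..<n} <+> {..<n}) (bichromatic_edges T)"

definition bichromatic_mst_cost ::
  "('p \<Rightarrow> 'p \<Rightarrow> real) \<Rightarrow> nat \<Rightarrow> (nat \<Rightarrow> 'p) \<Rightarrow> (nat \<Rightarrow> 'p) \<Rightarrow> real" where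
  "bichromatic_mst_cost d n R B =
     Min {(\<Sum>(i, j)\<in>T. d (R i) (B j)) | T. bichromatic_spanning_tree n T}"

definition random_submultiset :: "nat \<Rightarrow> nat \<Rightarrow> nat \<Rightarrow> (nat \<Rightarrow> nat list) pmf" where
  "random_submultiset b \<delta> n = Pi_pmf {..<n} [] (\<lambda>_. pmf_of_set (hst_leaves b \<delta>))"

definition expected_bichromatic_mst_cost :: "nat \<Rightarrow> nat \<Rightarrow> real \<Rightarrow> nat \<Rightarrow> real" where
  "expected_bichromatic_mst_cost b \<delta> lam n =
     measure_pmf.expectation (pair_pmf (random_submultiset b \<delta> n) (random_submultiset b \<delta> n))
       (\<lambda>(R, B). bichromatic_mst_cost (hst_dist b \<delta> lam) n R B)"

end

theory Submission
  imports Defs "HOL-Library.Sublist"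
begin

text \<open>
  The distance of two leaves is the sum of \<open>2 \<lambda>\<^sup>l\<close> over the levels \<open>l\<close> at which their ancestors
  differ, so the cost of a spanning tree is the sum over \<open>l\<close> of \<open>2 \<lambda>\<^sup>l\<close> times the number of its
  edges that join different nodes of level \<open>l\<close>. If \<open>N\<close> nodes of level \<open>l\<close> contain red points, each of
  them is left by such an edge, so there are at least \<open>(N - 1) / 2\<close> of them, and for \<open>b\<^sup>l \<le> n\<close> the
  expectation of \<open>N\<close> is at least \<open>(1 - 1/e) b\<^sup>l\<close>.

  Conversely, a spanning tree can be chosen in which the cost at level \<open>l\<close> is governed by the number
  of bichromatic nodes of level \<open>l\<close>, which is at most \<open>min (b\<^sup>l) n\<close>, and the number of points whose
  ancestor at level \<open>l\<close> is monochromatic, whose expectation is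
  \<open>2 n (1 - b\<^sup>-\<^sup>l)\<^sup>n \<le> 2 min (b\<^sup>l) n\<close>. Beyond level \<open>log\<^sub>b n\<close> the bound decays geometrically.
\<close>

section \<open>Spanning trees of connected graphs\<close>

lemma is_path_successively:
  "is_path E p \<longleftrightarrow> p \<noteq> [] \<and> distinct p \<and> successively (\<lambda>u v. {u, v} \<in> E) p"
  by (simp add: is_path_def successively_conv_nth)

lemma is_path_Cons_Cons:
  "is_path E (x # y # p) \<longleftrightarrow> x \<notin> set (y # p) \<and> {x, y} \<in> E \<and> is_path E (y # p)"
  by (auto simp: is_path_successively)

lemma path_weight_Cons_Cons: "path_weight w (x # y # p) = w x y + path_weight w (y # p)"
  unfolding path_weight_def by (simp del: sum.lessThan_Suc add: sum.lessThan_Suc_shift)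

text \<open>The graph as a symmetric relation: connectivity becomes membership in the reflexive
  transitive closure, where relational induction is available.\<close>

definition adj :: "'v set set \<Rightarrow> ('v \<times> 'v) set" where
  "adj E = {(u, v). {u, v} \<in> E}"

lemma adj_iff: "(u, v) \<in> adj E \<longleftrightarrow> {u, v} \<in> E"
  by (simp add: adj_def)

lemma sym_adj_rtrancl: "sym ((adj E)\<^sup>*)"
  by (intro sym_rtrancl symI) (auto simp: adj_def insert_commute)

lemma is_path_imp_reach: "is_path E p \<Longrightarrow> (hd p, last p) \<in> (adj E)\<^sup>*"
proof (induction p)
  case (Cons x p)
  show ?case
  proof (cases p)
    case (Cons y q)
    with Cons.prems have "(x, y) \<in> adj E" "is_path E p"
      by (auto simp: is_path_Cons_Cons adj_iff)
    with Cons.IH Cons show ?thesis by (auto intro: converse_rtrancl_into_rtrancl)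
  qed simp
qed (simp add: is_path_def)

text \<open>A walk is turned into a path by adding vertices at its front; if the new vertex already
  lies on the path, only the part of the path from that vertex on is kept.\<close>

lemma reach_imp_path:
  assumes "(u, v) \<in> (adj E)\<^sup>*"
  shows "\<exists>p. path_between E u p v"
  using assms
proof (induction rule: converse_rtrancl_induct)
  case base
  have "path_between E v [v] v" by (simp add: path_between_def is_path_def)
  then show ?case ..
next
  case (step u u')
  then obtain p where p: "is_path E p" "hd p = u'" "last p = v" by (auto simp: path_between_def)
  then obtain q where q: "p = u' # q" by (cases p) (auto simp: is_path_def)
  show ?case
  proof (cases "u \<in> set p")
    case True
    then obtain p1 p2 where "p = p1 @ u # p2" by (auto simp: in_set_conv_decomp)
    with p have "path_between E u (u # p2) v"
      by (auto simp: path_between_def is_path_successively successively_append_iff)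
    then show ?thesis ..
  next
    case False
    with p q step.hyps have "path_between E u (u # p) v"
      by (auto simp: path_between_def is_path_Cons_Cons adj_iff)
    then show ?thesis ..
  qed
qed

lemma is_tree_connected:
  "is_tree V E \<Longrightarrow> u \<in> V \<Longrightarrow> v \<in> V \<Longrightarrow> (u, v) \<in> (adj E)\<^sup>*"
  unfolding is_tree_def path_between_def using is_path_imp_reach by fast

lemma adj_rtrancl_crossing_edge:
  assumes "(u, v) \<in> (adj E)\<^sup>*" "u \<in> A" "v \<notin> A"
  shows "\<exists>x y. {x, y} \<in> E \<and> x \<in> A \<and> y \<notin> A"
  using assms by (induction rule: rtrancl_induct) (auto simp: adj_iff)

text \<open>A connected subgraph with the fewest edges has no cycle: the edge closing a cycle could
  be dropped, since the rest of the cycle still joins its ends.\<close>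

lemma connected_imp_spanning_tree:
  assumes "finite E" "V \<noteq> {}"
    and edges: "E \<subseteq> {{u, v} | u v. u \<in> V \<and> v \<in> V \<and> u \<noteq> v}"
    and conn: "V \<times> V \<subseteq> (adj E)\<^sup>*"
  shows "\<exists>F\<subseteq>E. is_tree V F"
proof -
  define P where "P F \<longleftrightarrow> F \<subseteq> E \<and> V \<times> V \<subseteq> (adj F)\<^sup>*" for F
  have "P E" using conn by (simp add: P_def)
  then obtain F where F: "P F" and min: "\<And>G. P G \<Longrightarrow> card F \<le> card G"
    using arg_min_nat_lemma[of P E card] by blast
  have False if "is_cycle F p" for p
  proof -
    define e where "e = {last p, hd p}"
    have p: "is_path F p" "length p \<ge> 3" "e \<in> F"
      using that by (auto simp: is_cycle_def e_def)
    \<comment> \<open>The closing edge is no edge of the path: the vertices are distinct, so it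
      would have to sit at adjacent positions as well as at the first and last one, which a length
      of at least 3 excludes.\<close>
    have "{p ! i, p ! Suc i} \<noteq> e" if "Suc i < length p" for i
    proof
      assume eq: "{p ! i, p ! Suc i} = e"
      have "e = {p ! (length p - 1), p ! 0}"
        using p(1) by (simp add: e_def is_path_def last_conv_nth hd_conv_nth)
      with eq have "{i, Suc i} = {length p - 1, 0}"
        using p(1) that by (auto simp: doubleton_eq_iff is_path_def nth_eq_iff_index_eq)
      with p(2) show False by (auto simp: doubleton_eq_iff)
    qed
    with p have "is_path (F - {e}) p" by (auto simp: is_path_def)
    then have e: "(hd p, last p) \<in> (adj (F - {e}))\<^sup>*" by (rule is_path_imp_reach)
    then have e': "(last p, hd p) \<in> (adj (F - {e}))\<^sup>*"
      by (rule symD[OF sym_adj_rtrancl])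
    have "(u, v) \<in> (adj (F - {e}))\<^sup>*" if "{u, v} \<in> F" for u v
    proof (cases "{u, v} = e")
      case True
      with e e' show ?thesis by (auto simp: e_def doubleton_eq_iff)
    next
      case False
      with that show ?thesis by (intro r_into_rtrancl) (simp add: adj_iff)
    qed
    then have "adj F \<subseteq> (adj (F - {e}))\<^sup>*" by (auto simp: adj_iff)
    then have "(adj F)\<^sup>* \<subseteq> (adj (F - {e}))\<^sup>*"
      by (rule rtrancl_subset_rtrancl)
    with F have "P (F - {e})" by (auto simp: P_def)
    from min[OF this] have "card F \<le> card (F - {e})" .
    moreover have "finite F" using F assms(1) by (auto simp: P_def intro: finite_subset)
    ultimately show False using p(3) card_Diff1_less[of F e] by simp
  qed
  moreover have "\<exists>p. path_between F u p v" if "u \<in> V" "v \<in> V" for u v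
    using F that by (intro reach_imp_path) (auto simp: P_def)
  ultimately show ?thesis
    using F assms(2) edges unfolding P_def is_tree_def by (intro exI[of _ F]) blast
qed

section \<open>Distances of leaves\<close>

lemma hst_edge_cases:
  assumes "{u, v} \<in> hst_edges b \<delta>"
  shows "(\<exists>c. v = u @ [c]) \<or> (\<exists>c. u = v @ [c])"
  using assms by (auto simp: hst_edges_def doubleton_eq_iff)

text \<open>Removing the parent of \<open>z\<close> cuts the subtree of \<open>z\<close> off, and removing \<open>z\<close> does so from
  the other side; hence every step of a path is determined by its endpoint.\<close>

lemma hst_path_stays_below:
  assumes "is_path (hst_edges b \<delta>) p" "prefix (x @ [c]) (hd p)" "x \<notin> set p"
  shows "prefix (x @ [c]) (last p)"
  using assms
proof (induction p)
  case (Cons u p)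
  show ?case
  proof (cases p)
    case (Cons v q)
    have *: "{u, v} \<in> hst_edges b \<delta>" "is_path (hst_edges b \<delta>) p"
      using Cons.prems Cons by (auto simp: is_path_Cons_Cons)
    have "v \<noteq> x" using Cons.prems Cons by auto
    then have "prefix (x @ [c]) v"
      using hst_edge_cases[OF *(1)] Cons.prems(2) by auto
    with Cons.IH * Cons.prems Cons show ?thesis by auto
  qed (use Cons.prems in simp)
qed (simp add: is_path_def)

lemma hst_path_stays_outside:
  assumes "is_path (hst_edges b \<delta>) p" "\<not> prefix x (hd p)" "x \<notin> set p"
  shows "\<not> prefix x (last p)"
  using assms
proof (induction p)
  case (Cons u p)
  show ?case
  proof (cases p)
    case (Cons v q)
    have *: "{u, v} \<in> hst_edges b \<delta>" "is_path (hst_edges b \<delta>) p"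
      using Cons.prems Cons by (auto simp: is_path_Cons_Cons)
    have "v \<noteq> x" using Cons.prems Cons by auto
    then have "\<not> prefix x v"
      using hst_edge_cases[OF *(1)] Cons.prems(2) by auto
    with Cons.IH * Cons.prems Cons show ?thesis by auto
  qed (use Cons.prems in simp)
qed (simp add: is_path_def)

text \<open>After a step down from \<open>x\<close> the path cannot return through \<open>x\<close>,
  so it ends below the child; after a step up it cannot re-enter the subtree of \<open>x\<close>.
  Whether \<open>y\<close> lies below \<open>x\<close> therefore decides the direction.\<close>

lemma hst_path_step:
  assumes "is_path (hst_edges b \<delta>) (x # x' # p)" "last (x' # p) = y"
  shows "if prefix x y then \<exists>c. x' = x @ [c] \<and> prefix x' y else \<exists>c. x = x' @ [c]"
proof -
  have e: "{x, x'} \<in> hst_edges b \<delta>" "is_path (hst_edges b \<delta>) (x' # p)" "x \<notin> set (x' # p)"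
    using assms by (auto simp: is_path_Cons_Cons)
  from hst_edge_cases[OF e(1)] show ?thesis
  proof
    assume "\<exists>c. x' = x @ [c]"
    then obtain c where c: "x' = x @ [c]" ..
    with hst_path_stays_below[OF e(2), of x c] e(3) assms(2) have "prefix x' y" by simp
    with c show ?thesis by (auto dest: append_prefixD)
  next
    assume "\<exists>c. x = x' @ [c]"
    then obtain c where c: "x = x' @ [c]" ..
    with hst_path_stays_outside[OF e(2), of x] e(3) assms(2) have "\<not> prefix x y" by auto
    with c show ?thesis by auto
  qed
qed

text \<open>Both paths make the same first step: to the child that is a prefix of \<open>y\<close>
  if there is one, and to the parent otherwise.\<close>

lemma hst_path_unique:
  assumes "path_between (hst_edges b \<delta>) x p y" "path_between (hst_edges b \<delta>) x q y"
  shows "p = q"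
  using assms
proof (induction p arbitrary: x q)
  case (Cons u p)
  note IH = Cons.IH and pq = Cons.prems
  have [simp]: "u = x" using pq by (simp add: path_between_def)
  obtain q' where q: "q = x # q'" using pq(2) by (cases q) (auto simp: path_between_def is_path_def)
  show ?case
  proof (cases "p = [] \<or> q' = []")
    case True
    \<comment> \<open>A path from \<open>x\<close> to \<open>x\<close> has no further vertex, as its
      last vertex would be a repetition. So if one path is a single vertex, both are.\<close>
    have "y \<notin> set p" if "x = y" using pq(1) that by (auto simp: path_between_def is_path_def)
    moreover have "y \<notin> set q'" if "x = y" using pq(2) q that by (auto simp: path_between_def is_path_def)
    ultimately show ?thesis using True pq q
      by (auto simp: path_between_def split: if_splits)
  next
    case False
    then obtain v p1 w q1 where eq: "p = v # p1" "q' = w # q1" by (meson neq_Nil_conv)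
    have "if prefix x y then \<exists>c. v = x @ [c] \<and> prefix v y else \<exists>c. x = v @ [c]"
      using pq(1) eq by (intro hst_path_step[of b \<delta> x v p1 y]) (auto simp: path_between_def)
    moreover have "if prefix x y then \<exists>c. w = x @ [c] \<and> prefix w y else \<exists>c. x = w @ [c]"
      using pq(2) q eq by (intro hst_path_step[of b \<delta> x w q1 y]) (auto simp: path_between_def)
    ultimately have "v = w"
      by (cases "prefix x y") (auto dest: prefix_same_cases)
    then have "p = q'" using pq q eq
      by (intro IH[of v]) (auto simp: path_between_def is_path_Cons_Cons)
    then show ?thesis using q by simp
  qed
qed (simp add: path_between_def is_path_def)

lemma hst_reach_root:
  assumes "set v \<subseteq> {..<b}" "length v \<le> \<delta>"
  shows "(v, []) \<in> (adj (hst_edges b \<delta>))\<^sup>*"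
  using assms
proof (induction v rule: rev_induct)
  case (snoc c v)
  then have "{v, v @ [c]} \<in> hst_edges b \<delta>"
    unfolding hst_edges_def by (intro CollectI exI[of _ v] exI[of _ c]) auto
  then have "(v @ [c], v) \<in> adj (hst_edges b \<delta>)"
    by (simp add: adj_iff insert_commute)
  moreover have "(v, []) \<in> (adj (hst_edges b \<delta>))\<^sup>*" using snoc by simp
  ultimately show ?case by (rule converse_rtrancl_into_rtrancl)
qed simp

lemma hst_path_exists:
  assumes "x \<in> hst_leaves b \<delta>" "y \<in> hst_leaves b \<delta>"
  shows "\<exists>p. path_between (hst_edges b \<delta>) x p y"
proof (rule reach_imp_path)
  have "(x, []) \<in> (adj (hst_edges b \<delta>))\<^sup>*" "(y, []) \<in> (adj (hst_edges b \<delta>))\<^sup>*"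
    using assms by (auto simp: hst_leaves_def intro: hst_reach_root)
  then show "(x, y) \<in> (adj (hst_edges b \<delta>))\<^sup>*"
    by (blast intro: rtrancl_trans symD[OF sym_adj_rtrancl])
qed

section \<open>The leaf distance as a sum over levels\<close>

text \<open>The vertex itself is included and the root is not: a vertex other than the root stands
  for the edge to its parent, whose weight is \<open>lam ^ length v\<close>.\<close>

definition ancestors :: "'a list \<Rightarrow> 'a list set" where
  "ancestors x = (\<lambda>k. take k x) ` {1..length x}"

lemma ancestors_iff: "v \<in> ancestors x \<longleftrightarrow> v \<noteq> [] \<and> prefix v x"
proof
  assume "v \<noteq> [] \<and> prefix v x"
  then have "v = take (length v) x" "length v \<in> {1..length x}"
    by (auto simp: prefix_def Suc_le_eq)
  then show "v \<in> ancestors x" unfolding ancestors_def by (rule image_eqI)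
qed (auto simp: ancestors_def take_is_prefix)

lemma finite_ancestors [simp]: "finite (ancestors x)"
  by (simp add: ancestors_def)

lemma ancestors_snoc: "ancestors (x @ [c]) = insert (x @ [c]) (ancestors x)"
  by (auto simp: ancestors_iff)

text \<open>Induction along the path: each step removes exactly one vertex from the symmetric
  difference, namely the lower end of the edge used, and the weight of the step is the term of that
  vertex.\<close>

lemma hst_path_weight:
  assumes "path_between (hst_edges b \<delta>) x p y"
  shows "path_weight (hst_weight lam) p =
    (\<Sum>v\<in>(ancestors x - ancestors y) \<union> (ancestors y - ancestors x). lam ^ length v)"
  using assms
proof (induction p arbitrary: x)
  case (Cons u p)
  note IH = Cons.IH and px = Cons.prems
  have [simp]: "u = x" using px by (simp add: path_between_def)
  show ?case
  proof (cases p)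
    case Nil
    with px have "y = x" by (simp add: path_between_def)
    with Nil show ?thesis by (simp add: path_weight_def)
  next
    case (Cons x' q)
    have w: "path_weight (hst_weight lam) (u # p) = hst_weight lam x x' +
      (\<Sum>v\<in>(ancestors x' - ancestors y) \<union> (ancestors y - ancestors x'). lam ^ length v)"
      using IH[of x'] px Cons by (simp add: path_weight_Cons_Cons path_between_def is_path_Cons_Cons)
    have step: "if prefix x y then \<exists>c. x' = x @ [c] \<and> prefix x' y else \<exists>c. x = x' @ [c]"
      using px Cons by (intro hst_path_step[of b \<delta> x x' q y]) (auto simp: path_between_def)
    show ?thesis
    proof (cases "prefix x y")
      case True
      with step obtain c where c: "x' = x @ [c]" "prefix x' y" by auto
      then have hw: "hst_weight lam x x' = lam ^ length x'" by (simp add: hst_weight_def)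
      from c have "(ancestors x - ancestors y) \<union> (ancestors y - ancestors x) =
        insert x' ((ancestors x' - ancestors y) \<union> (ancestors y - ancestors x'))"
        by (auto simp: ancestors_snoc ancestors_iff)
      moreover have "x' \<notin> (ancestors x' - ancestors y) \<union> (ancestors y - ancestors x')"
        using c by (auto simp: ancestors_iff)
      ultimately show ?thesis using w c hw by simp
    next
      case False
      with step obtain c where c: "x = x' @ [c]" by auto
      then have hw: "hst_weight lam x x' = lam ^ length x" by (simp add: hst_weight_def)
      from c False have "(ancestors x - ancestors y) \<union> (ancestors y - ancestors x) =
        insert x ((ancestors x' - ancestors y) \<union> (ancestors y - ancestors x'))"
        by (auto simp: ancestors_snoc ancestors_iff)
      moreover have "x \<notin> (ancestors x' - ancestors y) \<union> (ancestors y - ancestors x')"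
        using c False by (auto simp: ancestors_iff)
      ultimately show ?thesis using w c hw by simp
    qed
  qed
qed (simp add: path_between_def is_path_def)

lemma sum_ancestors_diff:
  assumes "length x = \<delta>" "length y = \<delta>"
  shows "(\<Sum>v\<in>ancestors x - ancestors y. lam ^ length v) =
    (\<Sum>k=1..\<delta>. lam ^ k * of_bool (take k x \<noteq> take k y) :: real)"
proof -
  have "ancestors x - ancestors y = (\<lambda>k. take k x) ` {k\<in>{1..\<delta>}. take k x \<noteq> take k y}"
  proof (intro equalityI subsetI)
    fix v assume "v \<in> ancestors x - ancestors y"
    then obtain k where "k \<in> {1..\<delta>}" "v = take k x" "v \<notin> ancestors y"
      using assms by (auto simp: ancestors_def)
    then show "v \<in> (\<lambda>k. take k x) ` {k\<in>{1..\<delta>}. take k x \<noteq> take k y}"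
      using assms by (auto simp: ancestors_def)
  next
    fix v assume "v \<in> (\<lambda>k. take k x) ` {k\<in>{1..\<delta>}. take k x \<noteq> take k y}"
    then obtain k where k: "k \<in> {1..\<delta>}" "v = take k x" "take k x \<noteq> take k y" by auto
    have "v \<notin> ancestors y"
    proof
      assume "v \<in> ancestors y"
      then obtain j where "j \<in> {1..\<delta>}" "take k x = take j y" using k assms by (auto simp: ancestors_def)
      moreover from this have "j = k"
        using k assms by (auto dest: arg_cong[of _ _ length])
      ultimately show False using k by simp
    qed
    with k assms show "v \<in> ancestors x - ancestors y" by (auto simp: ancestors_def)
  qed
  moreover have "inj_on (\<lambda>k. take k x) {k\<in>{1..\<delta>}. take k x \<noteq> take k y}"
    using assms by (intro inj_onI) (auto dest: arg_cong[of _ _ length])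
  ultimately have "(\<Sum>v\<in>ancestors x - ancestors y. lam ^ length v) =
      (\<Sum>k\<in>{k\<in>{1..\<delta>}. take k x \<noteq> take k y}. lam ^ length (take k x))"
    by (simp add: sum.reindex)
  also have "\<dots> = (\<Sum>k\<in>{k\<in>{1..\<delta>}. take k x \<noteq> take k y}. lam ^ k)"
    using assms by (intro sum.cong) auto
  also have "\<dots> = (\<Sum>k=1..\<delta>. lam ^ k * of_bool (take k x \<noteq> take k y))"
    unfolding sum.inter_filter[OF finite_atLeastAtMost] by (rule sum.cong) auto
  finally show ?thesis .
qed

text \<open>The closed form of the leaf distance. The factor 2 counts the edges above the two
  different ancestors at level \<open>k\<close>.\<close>

definition cut_dist :: "nat \<Rightarrow> real \<Rightarrow> 'a list \<Rightarrow> 'a list \<Rightarrow> real" where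
  "cut_dist \<delta> lam x y = (\<Sum>k=1..\<delta>. 2 * lam ^ k * of_bool (take k x \<noteq> take k y))"

lemma hst_dist_eq_cut_dist:
  assumes "x \<in> hst_leaves b \<delta>" "y \<in> hst_leaves b \<delta>"
  shows "hst_dist b \<delta> lam x y = cut_dist \<delta> lam x y"
proof -
  obtain p where p: "path_between (hst_edges b \<delta>) x p y"
    using hst_path_exists[OF assms] ..
  then have "(THE p. path_between (hst_edges b \<delta>) x p y) = p"
    by (intro the_equality) (auto intro: hst_path_unique)
  then have "hst_dist b \<delta> lam x y =
      (\<Sum>v\<in>(ancestors x - ancestors y) \<union> (ancestors y - ancestors x). lam ^ length v)"
    by (simp add: hst_dist_def tree_dist_def hst_path_weight[OF p])
  also have "\<dots> = (\<Sum>v\<in>ancestors x - ancestors y. lam ^ length v) +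
      (\<Sum>v\<in>ancestors y - ancestors x. lam ^ length v)"
    by (intro sum.union_disjoint) auto
  also have "\<dots> = cut_dist \<delta> lam x y"
  proof -
    have "(\<Sum>v\<in>ancestors x - ancestors y. lam ^ length v) =
        (\<Sum>k=1..\<delta>. lam ^ k * of_bool (take k x \<noteq> take k y))"
      using assms by (intro sum_ancestors_diff) (auto simp: hst_leaves_def)
    moreover have "(\<Sum>v\<in>ancestors y - ancestors x. lam ^ length v) =
        (\<Sum>k=1..\<delta>. lam ^ k * of_bool (take k y \<noteq> take k x))"
      using assms by (intro sum_ancestors_diff) (auto simp: hst_leaves_def)
    ultimately show ?thesis
      unfolding cut_dist_def by (simp only: flip: sum.distrib) (rule sum.cong, auto)
  qed
  finally show ?thesis .
qed

section \<open>Deterministic bounds on the cost\<close>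

lemma bichromatic_edges_iff [simp]:
  "{Inl i, Inr j} \<in> bichromatic_edges T \<longleftrightarrow> (i, j) \<in> T"
  "{Inr j, Inl i} \<in> bichromatic_edges T \<longleftrightarrow> (i, j) \<in> T"
  by (auto simp: bichromatic_edges_def doubleton_eq_iff)

lemma finite_bichromatic_spanning_trees: "finite {T. bichromatic_spanning_tree n T}"
  by (rule finite_subset[of _ "Pow ({..<n} \<times> {..<n})"]) (auto simp: bichromatic_spanning_tree_def)

lemma bichromatic_connected_imp_spanning_tree:
  assumes "n > 0" "T \<subseteq> {..<n} \<times> {..<n}"
    and "({..<n} <+> {..<n}) \<times> ({..<n} <+> {..<n}) \<subseteq> (adj (bichromatic_edges T))\<^sup>*"
  shows "\<exists>U\<subseteq>T. bichromatic_spanning_tree n U"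
proof -
  have "finite T" using assms(2) by (rule finite_subset) simp
  have "\<exists>F\<subseteq>bichromatic_edges T. is_tree ({..<n} <+> {..<n}) F"
  proof (rule connected_imp_spanning_tree[OF _ _ _ assms(3)])
    show "finite (bichromatic_edges T)" using \<open>finite T\<close> by (simp add: bichromatic_edges_def)
    show "bichromatic_edges T \<subseteq>
        {{u, v} | u v. u \<in> {..<n} <+> {..<n} \<and> v \<in> {..<n} <+> {..<n} \<and> u \<noteq> v}"
      using assms(2) by (fastforce simp: bichromatic_edges_def)
  qed (use assms(1) in auto)
  then show ?thesis
    using assms(2) unfolding bichromatic_spanning_tree_def bichromatic_edges_def subset_image_iff
    by (metis (no_types, lifting) order_trans)
qed

text \<open>A connected graph contains a spanning tree, and dropping edges of nonnegative length
  saves cost. For upper bounds it thus suffices to construct a connected graph.\<close>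

lemma bichromatic_mst_cost_le:
  assumes "n > 0" "T \<subseteq> {..<n} \<times> {..<n}"
    and "({..<n} <+> {..<n}) \<times> ({..<n} <+> {..<n}) \<subseteq> (adj (bichromatic_edges T))\<^sup>*"
    and "\<And>x y. d x y \<ge> 0"
  shows "bichromatic_mst_cost d n R B \<le> (\<Sum>(i, j)\<in>T. d (R i) (B j))"
proof -
  obtain U where U: "U \<subseteq> T" "bichromatic_spanning_tree n U"
    using bichromatic_connected_imp_spanning_tree[OF assms(1-3)] by auto
  have "bichromatic_mst_cost d n R B \<le> (\<Sum>(i, j)\<in>U. d (R i) (B j))"
    unfolding bichromatic_mst_cost_def
    using U(2) finite_bichromatic_spanning_trees[of n] by (intro Min_le) auto
  also have "\<dots> \<le> (\<Sum>(i, j)\<in>T. d (R i) (B j))"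
    using U(1) assms(4) by (intro sum_mono2 finite_subset[OF assms(2)]) auto
  finally show ?thesis .
qed

text \<open>The complete bipartite graph is connected through the red point 0, so the finite set of
  costs is nonempty and \<open>Min\<close> is one of its elements.\<close>

lemma bichromatic_mst_cost_attained:
  assumes "n > 0"
  shows "\<exists>T. bichromatic_spanning_tree n T \<and>
    bichromatic_mst_cost d n R B = (\<Sum>(i, j)\<in>T. d (R i) (B j))"
proof -
  let ?S = "adj (bichromatic_edges ({..<n} \<times> {..<n}))"
  have root: "(u, Inl 0) \<in> ?S\<^sup>*" if u: "u \<in> {..<n} <+> {..<n}" for u
  proof (cases u)
    case (Inl i)
    with u assms have "(u, Inr 0) \<in> ?S" "(Inr 0, Inl 0) \<in> ?S" by (auto simp: adj_iff)
    then show ?thesis by auto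
  next
    case (Inr j)
    with u assms have "(u, Inl 0) \<in> ?S" by (auto simp: adj_iff)
    then show ?thesis by auto
  qed
  have "(u, v) \<in> ?S\<^sup>*" if "u \<in> {..<n} <+> {..<n}" "v \<in> {..<n} <+> {..<n}" for u v
    using root[OF that(1)] symD[OF sym_adj_rtrancl root[OF that(2)]] by (rule rtrancl_trans)
  then have "\<exists>T\<subseteq>{..<n} \<times> {..<n}. bichromatic_spanning_tree n T"
    using assms by (intro bichromatic_connected_imp_spanning_tree) auto
  then have "bichromatic_mst_cost d n R B \<in>
      {(\<Sum>(i, j)\<in>T. d (R i) (B j)) | T. bichromatic_spanning_tree n T}"
    unfolding bichromatic_mst_cost_def
    using finite_bichromatic_spanning_trees[of n] by (intro Min_in) auto
  then show ?thesis by auto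
qed

lemma bichromatic_mst_cost_cong:
  assumes "\<And>i j. i < n \<Longrightarrow> j < n \<Longrightarrow> d (R i) (B j) = d' (R i) (B j)"
  shows "bichromatic_mst_cost d n R B = bichromatic_mst_cost d' n R B"
proof -
  have "(\<Sum>(i, j)\<in>T. d (R i) (B j)) = (\<Sum>(i, j)\<in>T. d' (R i) (B j))"
    if "bichromatic_spanning_tree n T" for T
    using that assms by (intro sum.cong) (auto simp: bichromatic_spanning_tree_def)
  then show ?thesis unfolding bichromatic_mst_cost_def
    by (intro arg_cong[of _ _ Min]) force
qed

text \<open>If the red points meet at least two classes of \<open>f\<close>, the tree has to leave
  each of these classes, and one edge has ends in at most two of them. The summand 1 covers the case
  of a single class, where no edge need cross.\<close>

lemma card_image_le_crossing_edges:
  assumes T: "bichromatic_spanning_tree n T"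
  shows "card ((\<lambda>i. f (R i)) ` {..<n}) \<le> 2 * card {(i, j)\<in>T. f (R i) \<noteq> f (B j)} + 1"
proof (cases "card ((\<lambda>i. f (R i)) ` {..<n}) \<le> 1")
  case False
  let ?N = "(\<lambda>i. f (R i)) ` {..<n}" and ?X = "{(i, j)\<in>T. f (R i) \<noteq> f (B j)}"
  have fin: "finite ?X" using T
    by (intro finite_subset[of ?X "{..<n} \<times> {..<n}"]) (auto simp: bichromatic_spanning_tree_def)
  have "v \<in> (\<lambda>(i, j). f (R i)) ` ?X \<union> (\<lambda>(i, j). f (B j)) ` ?X" if v: "v \<in> ?N" for v
  proof -
    from v obtain i where i: "i < n" "f (R i) = v" by auto
    have "\<not> ?N \<subseteq> {v}" using False card_mono[of "{v}" ?N] by auto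
    then obtain i' where i': "i' < n" "f (R i') \<noteq> v" by auto
    \<comment> \<open>All points of class \<open>v\<close>, red and blue; the tree path from
      \<open>i\<close> to \<open>i'\<close> leaves this set.\<close>
    define A where "A = {u. case u of Inl i \<Rightarrow> f (R i) = v | Inr j \<Rightarrow> f (B j) = v}"
    have "(Inl i, Inl i') \<in> (adj (bichromatic_edges T))\<^sup>*"
      using T i i' by (intro is_tree_connected) (auto simp: bichromatic_spanning_tree_def)
    moreover have "Inl i \<in> A" "Inl i' \<notin> A" using i i' by (auto simp: A_def)
    ultimately have "\<exists>x y. {x, y} \<in> bichromatic_edges T \<and> x \<in> A \<and> y \<notin> A"
      by (rule adj_rtrancl_crossing_edge)
    then obtain x y where xy: "{x, y} \<in> bichromatic_edges T" "x \<in> A" "y \<notin> A"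
      by (elim exE conjE)
    then obtain k l where kl: "(k, l) \<in> T" "{x, y} = {Inl k, Inr l}"
      by (auto simp: bichromatic_edges_def)
    then have "(k, l) \<in> ?X \<and> (f (R k) = v \<or> f (B l) = v)"
      using xy(2,3) by (auto simp: A_def doubleton_eq_iff)
    then show ?thesis by (force simp: image_iff)
  qed
  then have "card ?N \<le> card ((\<lambda>(i, j). f (R i)) ` ?X \<union> (\<lambda>(i, j). f (B j)) ` ?X)"
    using fin by (intro card_mono) auto
  also have "\<dots> \<le> card ((\<lambda>(i, j). f (R i)) ` ?X) + card ((\<lambda>(i, j). f (B j)) ` ?X)"
    by (rule card_Un_le)
  also have "\<dots> \<le> card ?X + card ?X" using fin by (intro add_mono card_image_le)
  finally show ?thesis by simp
qed simp

section \<open>Estimates for the leaf distance\<close>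

lemma cut_dist_nonneg: "lam \<ge> 0 \<Longrightarrow> cut_dist \<delta> lam x y \<ge> 0"
  by (simp add: cut_dist_def sum_nonneg)

lemma cut_dist_commute: "cut_dist \<delta> lam x y = cut_dist \<delta> lam y x"
  unfolding cut_dist_def by (rule sum.cong) auto

lemma power_tail_le:
  assumes "0 < lam" "lam < (1::real)"
  shows "(\<Sum>k=m..n. lam ^ k) \<le> lam ^ m / (1 - lam)"
proof (cases "m \<le> n")
  case True
  have "(1 - lam) * (\<Sum>k=m..n. lam ^ k) \<le> lam ^ m"
    using sum_gp_multiplied[OF True, of lam] assms by simp
  then show ?thesis using assms by (simp add: pos_le_divide_eq mult.commute)
qed (use assms in simp)

text \<open>Levels up to \<open>l\<close> contribute nothing, and the others form a geometric tail
  bounded independently of \<delta>.\<close>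

lemma cut_dist_le:
  assumes "0 < lam" "lam < 1" "take l x = take l y"
  shows "cut_dist \<delta> lam x y \<le> 2 * lam ^ Suc l / (1 - lam)"
proof -
  have eq: "take k x = take k y" if "k \<le> l" for k
    using arg_cong[OF assms(3), of "take k"] that by (simp add: min_absorb1)
  have "cut_dist \<delta> lam x y = (\<Sum>k\<in>{Suc l..\<delta>}. 2 * lam ^ k * of_bool (take k x \<noteq> take k y))"
    unfolding cut_dist_def
  proof (rule sum.mono_neutral_right)
    show "\<forall>k\<in>{1..\<delta>} - {Suc l..\<delta>}. 2 * lam ^ k * of_bool (take k x \<noteq> take k y) = 0"
      using eq by auto
  qed auto
  also have "\<dots> \<le> (\<Sum>k=Suc l..\<delta>. 2 * lam ^ k)"
    using assms by (intro sum_mono) auto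
  also have "\<dots> \<le> 2 * (lam ^ Suc l / (1 - lam))"
    unfolding sum_distrib_left[symmetric] using power_tail_le[of lam "Suc l" \<delta>] assms by simp
  finally show ?thesis by simp
qed

section \<open>The lower bound for given points\<close>

text \<open>The crossing edges of an optimal tree are counted at every level, with
  \<open>take l\<close> as the class function. The factor 2 of \<open>cut_dist\<close> makes up for
  the two ends of an edge.\<close>

lemma bichromatic_mst_cost_cut_dist_ge:
  assumes "n > 0" "lam > 0"
  shows "bichromatic_mst_cost (cut_dist \<delta> lam) n R B \<ge>
    (\<Sum>l=1..\<delta>. lam ^ l * (real (card ((\<lambda>i. take l (R i)) ` {..<n})) - 1))"
proof -
  obtain T where T: "bichromatic_spanning_tree n T"
    and cost: "bichromatic_mst_cost (cut_dist \<delta> lam) n R B = (\<Sum>(i, j)\<in>T. cut_dist \<delta> lam (R i) (B j))"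
    using bichromatic_mst_cost_attained[OF assms(1)] by blast
  have fin: "finite T" using T
    by (intro finite_subset[of T "{..<n} \<times> {..<n}"]) (auto simp: bichromatic_spanning_tree_def)
  have "(\<Sum>l=1..\<delta>. lam ^ l * (real (card ((\<lambda>i. take l (R i)) ` {..<n})) - 1)) \<le>
      (\<Sum>l=1..\<delta>. 2 * lam ^ l * real (card {(i, j)\<in>T. take l (R i) \<noteq> take l (B j)}))"
  proof (rule sum_mono)
    fix l
    have "real (card ((\<lambda>i. take l (R i)) ` {..<n})) - 1
        \<le> 2 * real (card {(i, j)\<in>T. take l (R i) \<noteq> take l (B j)})"
      using card_image_le_crossing_edges[OF T, of "take l" R B] by linarith
    then show "lam ^ l * (real (card ((\<lambda>i. take l (R i)) ` {..<n})) - 1)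
        \<le> 2 * lam ^ l * real (card {(i, j)\<in>T. take l (R i) \<noteq> take l (B j)})"
      using assms(2) mult_left_mono[of _ _ "lam ^ l"] by (fastforce simp: ac_simps)
  qed
  also have "\<dots> = (\<Sum>l=1..\<delta>. \<Sum>(i, j)\<in>T. 2 * lam ^ l * of_bool (take l (R i) \<noteq> take l (B j)))"
  proof (rule sum.cong[OF refl])
    fix l
    have "real (card {(i, j)\<in>T. take l (R i) \<noteq> take l (B j)}) =
        (\<Sum>(i, j)\<in>T. of_bool (take l (R i) \<noteq> take l (B j)))"
      using fin by (simp add: case_prod_unfold Int_def)
    then show "2 * lam ^ l * real (card {(i, j)\<in>T. take l (R i) \<noteq> take l (B j)}) =
        (\<Sum>(i, j)\<in>T. 2 * lam ^ l * of_bool (take l (R i) \<noteq> take l (B j)))"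
      by (simp only: sum_distrib_left case_prod_unfold)
  qed
  also have "\<dots> = (\<Sum>(i, j)\<in>T. cut_dist \<delta> lam (R i) (B j))"
    unfolding cut_dist_def case_prod_unfold by (rule sum.swap)
  finally show ?thesis using cost by simp
qed

section \<open>The upper bound for given points\<close>

text \<open>With \<open>l\<close> the greatest level at which \<open>x\<close> shares its ancestor
  with a member of \<open>Y\<close>, any \<open>y\<close> below that ancestor differs from
  \<open>x\<close> only at levels where \<open>x\<close> shares its ancestor with nobody in
  \<open>Y\<close>. The bound does not require \<open>y\<close> to be the member found, which leaves
  the choice of a representative free.\<close>

lemma deepest_common_ancestor:
  assumes "lam \<ge> 0" "Y \<noteq> {}"
  shows "\<exists>l\<le>\<delta>. take l x \<in> take l ` Y \<and> (\<forall>y. take l y = take l x \<longrightarrow>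
    cut_dist \<delta> lam x y \<le> (\<Sum>k=1..\<delta>. 2 * lam ^ k * of_bool (take k x \<notin> take k ` Y)))"
proof -
  define P where "P l \<longleftrightarrow> l \<le> \<delta> \<and> take l x \<in> take l ` Y" for l
  define l where "l = Greatest P"
  have "P 0" using assms(2) by (auto simp: P_def)
  then have "P l" unfolding l_def by (rule GreatestI_nat[where b = \<delta>]) (auto simp: P_def)
  have max: "k \<le> l" if "P k" for k
    using that unfolding l_def by (rule Greatest_le_nat[where b = \<delta>]) (auto simp: P_def)
  have "cut_dist \<delta> lam x y \<le> (\<Sum>k=1..\<delta>. 2 * lam ^ k * of_bool (take k x \<notin> take k ` Y))"
    if y: "take l y = take l x" for y
    unfolding cut_dist_def
  proof (intro sum_mono mult_left_mono)
    fix k assume k: "k \<in> {1..\<delta>}"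
    have "take k x = take k y" if "take k x \<in> take k ` Y"
    proof -
      have "k \<le> l" using that k by (intro max) (auto simp: P_def)
      then show ?thesis using arg_cong[OF y, of "take k"] by (simp add: min_absorb1)
    qed
    then show "of_bool (take k x \<noteq> take k y) \<le> (of_bool (take k x \<notin> take k ` Y) :: real)" by auto
  qed (use assms in auto)
  with \<open>P l\<close> show ?thesis by (auto simp: P_def)
qed

lemma sum_Un_le:
  assumes "finite A" "finite B" "\<And>x. f x \<ge> (0::real)"
  shows "sum f (A \<union> B) \<le> sum f A + sum f B"
proof -
  have "sum f (A \<inter> B) \<ge> 0" using assms(3) by (rule sum_nonneg)
  then show ?thesis using sum.union_inter[OF assms(1,2), of f] by linarith
qed

definition bichromatic_nodes :: "nat \<Rightarrow> (nat \<Rightarrow> 'a list) \<Rightarrow> (nat \<Rightarrow> 'a list) \<Rightarrow> nat \<Rightarrow> 'a list set" where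
  "bichromatic_nodes n R B l = (\<lambda>i. take l (R i)) ` {..<n} \<inter> (\<lambda>j. take l (B j)) ` {..<n}"

text \<open>A set of indices rather than of leaves, so that copies of a leaf are counted separately.
  Exchanging \<open>R\<close> and \<open>B\<close> gives the isolated blue points.\<close>

definition isolated_points :: "nat \<Rightarrow> (nat \<Rightarrow> 'a list) \<Rightarrow> (nat \<Rightarrow> 'a list) \<Rightarrow> nat \<Rightarrow> nat set" where
  "isolated_points n R B l = {i\<in>{..<n}. take l (R i) \<notin> take l ` B ` {..<n}}"

lemma bichromatic_nodes_commute: "bichromatic_nodes n R B l = bichromatic_nodes n B R l"
  by (auto simp: bichromatic_nodes_def)

text \<open>Here \<open>p i\<close> is the deepest bichromatic ancestor of the red point
  \<open>i\<close>. Joining \<open>i\<close> to any blue point below \<open>p i\<close> costs at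
  most \<open>2 * lam ^ k\<close> for each level \<open>k\<close> at which \<open>i\<close> is
  isolated; exchanging the sums over points and levels gives the bound.\<close>

lemma deepest_bichromatic_node:
  assumes lam: "lam \<ge> 0" and len: "\<And>i. i < n \<Longrightarrow> length (R i) = \<delta>"
  obtains p where "\<forall>i<n. \<exists>l\<le>\<delta>. p i \<in> bichromatic_nodes n R B l \<and> take l (R i) = p i"
    and "\<forall>f. (\<forall>i<n. take (length (p i)) (B (f i)) = p i) \<longrightarrow>
      (\<Sum>i<n. cut_dist \<delta> lam (R i) (B (f i))) \<le>
      (\<Sum>k=1..\<delta>. 2 * lam ^ k * real (card (isolated_points n R B k)))"
proof -
  let ?s = "\<lambda>i. \<Sum>k=1..\<delta>. 2 * lam ^ k * of_bool (take k (R i) \<notin> take k ` B ` {..<n})"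
  have "\<exists>v. i < n \<longrightarrow> (\<exists>l\<le>\<delta>. v \<in> bichromatic_nodes n R B l \<and> take l (R i) = v) \<and>
      (\<forall>y. take (length v) y = v \<longrightarrow> cut_dist \<delta> lam (R i) y \<le> ?s i)"
    (is "\<exists>v. ?P i v") for i
  proof (cases "i < n")
    case True
    then have "B ` {..<n} \<noteq> {}" by auto
    from deepest_common_ancestor[OF lam this, of \<delta> "R i"]
    obtain l where l: "l \<le> \<delta>" "take l (R i) \<in> take l ` B ` {..<n}"
      "\<forall>y. take l y = take l (R i) \<longrightarrow> cut_dist \<delta> lam (R i) y \<le> ?s i"
      by (elim exE conjE)
    have v: "take l (R i) \<in> bichromatic_nodes n R B l"
      unfolding bichromatic_nodes_def
    proof (rule IntI)
      show "take l (R i) \<in> (\<lambda>j. take l (B j)) ` {..<n}" using l(2) by (simp only: image_image)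
    qed (use True in auto)
    have len_v: "length (take l (R i)) = l" using l(1) len[OF True] by simp
    have "?P i (take l (R i))"
      unfolding len_v using l(1,3) v by (intro impI conjI exI[of _ l] refl)
    then show ?thesis by (rule exI[of "?P i"])
  next
    case False
    \<comment> \<open>A default value: nothing is claimed for indices outside the range.\<close>
    show ?thesis by (rule exI[of _ "[]"], rule impI, rule notE[OF False])
  qed
  then have "\<forall>i. \<exists>v. ?P i v" by (rule allI)
  from choice[OF this] obtain p where p: "\<forall>i. ?P i (p i)" by (rule exE)
  have "(\<Sum>i<n. cut_dist \<delta> lam (R i) (B (f i))) \<le>
      (\<Sum>k=1..\<delta>. 2 * lam ^ k * real (card (isolated_points n R B k)))"
    if f: "\<forall>i<n. take (length (p i)) (B (f i)) = p i" for f
  proof -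
    have "(\<Sum>i<n. cut_dist \<delta> lam (R i) (B (f i))) \<le> (\<Sum>i<n. ?s i)"
    proof (rule sum_mono)
      fix i assume "i \<in> {..<n}"
      then have "i < n" by simp
      with p[rule_format, of i] f show "cut_dist \<delta> lam (R i) (B (f i)) \<le> ?s i" by blast
    qed
    also have "\<dots> = (\<Sum>k=1..\<delta>. \<Sum>i<n. 2 * lam ^ k * of_bool (take k (R i) \<notin> take k ` B ` {..<n}))"
      by (rule sum.swap)
    also have "\<dots> = (\<Sum>k=1..\<delta>. 2 * lam ^ k * real (card (isolated_points n R B k)))"
    proof (rule sum.cong[OF refl])
      fix k
      have "(\<Sum>i<n. of_bool (take k (R i) \<notin> take k ` B ` {..<n})) =
          (\<Sum>i\<in>isolated_points n R B k. 1 :: real)"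
        unfolding isolated_points_def sum.inter_filter[OF finite_lessThan]
        by (rule sum.cong) (auto simp only: of_bool_def)
      then show "(\<Sum>i<n. 2 * lam ^ k * of_bool (take k (R i) \<notin> take k ` B ` {..<n})) =
          2 * lam ^ k * real (card (isolated_points n R B k))"
        by (simp only: flip: sum_distrib_left) simp
    qed
    finally show ?thesis .
  qed
  moreover have "\<forall>i<n. \<exists>l\<le>\<delta>. p i \<in> bichromatic_nodes n R B l \<and> take l (R i) = p i"
    using p by blast
  ultimately show thesis by (intro that[of p] allI impI) blast+
qed

text \<open>The same edge may arise from several nodes; as \<open>g\<close> is nonnegative, counting
  it once per node only enlarges the sum.\<close>

lemma sum_bichromatic_nodes_le:
  fixes g :: "nat \<times> nat \<Rightarrow> real"
  assumes "finite I" "\<And>e. g e \<ge> 0"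
    and "\<And>l v. l \<in> I \<Longrightarrow> v \<in> bichromatic_nodes n R B l \<Longrightarrow> g (f v) \<le> c l"
  shows "sum g (\<Union>l\<in>I. f ` bichromatic_nodes n R B l) \<le>
    (\<Sum>l\<in>I. real (card (bichromatic_nodes n R B l)) * c l)"
proof -
  let ?W = "bichromatic_nodes n R B"
  have fin: "finite (?W l)" for l by (simp add: bichromatic_nodes_def)
  have "(\<Union>l\<in>I. f ` ?W l) = (\<lambda>(l, v). f v) ` Sigma I ?W" by force
  then have "sum g (\<Union>l\<in>I. f ` ?W l) \<le> sum (g \<circ> (\<lambda>(l, v). f v)) (Sigma I ?W)"
    using assms(1,2) fin by (simp only:) (intro sum_image_le, auto)
  also have "\<dots> = (\<Sum>l\<in>I. \<Sum>v\<in>?W l. g (f v))"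
    using assms fin by (subst sum.Sigma) (auto simp: case_prod_unfold)
  also have "\<dots> \<le> (\<Sum>l\<in>I. \<Sum>v\<in>?W l. c l)" using assms by (intro sum_mono)
  finally show ?thesis by simp
qed

text \<open>Pick a red and a blue representative \<open>r v\<close> and \<open>s v\<close> below every bichromatic node \<open>v\<close>.
  Joining \<open>r v\<close> to \<open>s v\<close> and to the blue representative of the parent of \<open>v\<close>, and every point to the
  opposite representative of its deepest bichromatic ancestor, gives a connected graph.\<close>

lemma bichromatic_mst_cost_cut_dist_le:
  assumes n: "n > 0" and lam: "0 < lam" "lam < 1"
    and lenR: "\<And>i. i < n \<Longrightarrow> length (R i) = \<delta>" and lenB: "\<And>i. i < n \<Longrightarrow> length (B i) = \<delta>"
  shows "bichromatic_mst_cost (cut_dist \<delta> lam) n R B \<le>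
    2 * lam / (1 - lam) +
    (\<Sum>l=1..\<delta>. 4 / (1 - lam) * lam ^ l * real (card (bichromatic_nodes n R B l))) +
    (\<Sum>l=1..\<delta>. 2 * lam ^ l * real (card (isolated_points n R B l))) +
    (\<Sum>l=1..\<delta>. 2 * lam ^ l * real (card (isolated_points n B R l)))"
proof -
  let ?W = "bichromatic_nodes n R B"
  let ?d = "cut_dist \<delta> lam"
  \<comment> \<open>The level of a node is its length, so the representatives depend on the node
    alone.\<close>
  define r where "r v = (SOME i. i < n \<and> take (length v) (R i) = v)" for v
  define s where "s v = (SOME j. j < n \<and> take (length v) (B j) = v)" for v
  have lenW: "length v = l" if "v \<in> ?W l" "l \<le> \<delta>" for v l
    using that(2) lenR IntD1[OF that(1)[unfolded bichromatic_nodes_def]] by auto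
  have r: "r v < n \<and> take l (R (r v)) = v" if "v \<in> ?W l" "l \<le> \<delta>" for v l
  proof -
    have "\<exists>i. i < n \<and> take (length v) (R i) = v"
      using that lenW[OF that] by (auto simp: bichromatic_nodes_def)
    from someI_ex[OF this] show ?thesis using lenW[OF that] by (simp add: r_def)
  qed
  have s: "s v < n \<and> take l (B (s v)) = v" if "v \<in> ?W l" "l \<le> \<delta>" for v l
  proof -
    have "\<exists>i. i < n \<and> take (length v) (B i) = v"
      using that lenW[OF that] by (auto simp: bichromatic_nodes_def)
    from someI_ex[OF this] show ?thesis using lenW[OF that] by (simp add: s_def)
  qed
  \<comment> \<open>The parent of a bichromatic node is bichromatic, so it has representatives
    too.\<close>
  have parent: "butlast v \<in> ?W l" if v: "v \<in> ?W (Suc l)" "Suc l \<le> \<delta>" for v l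
  proof -
    have "butlast v = take l v" using lenW[OF v] by (simp add: butlast_conv_take)
    moreover obtain i j where "v = take (Suc l) (R i)" "i < n" "v = take (Suc l) (B j)" "j < n"
      using v(1) unfolding bichromatic_nodes_def by blast
    then have "take l v = take l (R i)" "take l v = take l (B j)" "i < n" "j < n"
      by (auto dest: arg_cong[of _ _ "take l"] simp: min_absorb1)
    ultimately show ?thesis
      unfolding bichromatic_nodes_def by (intro IntI image_eqI[of _ _ i] image_eqI[of _ _ j]) auto
  qed
  obtain p where p: "\<forall>i<n. \<exists>l\<le>\<delta>. p i \<in> ?W l \<and> take l (R i) = p i"
    and p_cost: "\<forall>f. (\<forall>i<n. take (length (p i)) (B (f i)) = p i) \<longrightarrow>
      (\<Sum>i<n. ?d (R i) (B (f i))) \<le> (\<Sum>k=1..\<delta>. 2 * lam ^ k * real (card (isolated_points n R B k)))"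
    by (rule deepest_bichromatic_node[of lam n R \<delta> B, OF less_imp_le[OF lam(1)]])
      (erule lenR)
  \<comment> \<open>The same for the blue points, with the colours exchanged.\<close>
  obtain q where q: "\<forall>i<n. \<exists>l\<le>\<delta>. q i \<in> ?W l \<and> take l (B i) = q i"
    and q_cost: "\<forall>f. (\<forall>i<n. take (length (q i)) (R (f i)) = q i) \<longrightarrow>
      (\<Sum>i<n. ?d (B i) (R (f i))) \<le> (\<Sum>k=1..\<delta>. 2 * lam ^ k * real (card (isolated_points n B R k)))"
    unfolding bichromatic_nodes_commute[of n R B]
    by (rule deepest_bichromatic_node[of lam n B \<delta> R, OF less_imp_le[OF lam(1)]])
      (erule lenB)
  define E1 where "E1 = (\<Union>l\<in>{..\<delta>}. (\<lambda>v. (r v, s v)) ` ?W l)"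
  \<comment> \<open>The root has no parent, so level 0 occurs in \<open>E1\<close> only.\<close>
  define E2 where "E2 = (\<Union>l\<in>{1..\<delta>}. (\<lambda>v. (r v, s (butlast v))) ` ?W l)"
  define E3 where "E3 = (\<lambda>i. (i, s (p i))) ` {..<n}"
  define E4 where "E4 = (\<lambda>j. (r (q j), j)) ` {..<n}"
  define T where "T = E1 \<union> E2 \<union> (E3 \<union> E4)"
  have sub: "T \<subseteq> {..<n} \<times> {..<n}"
  proof -
    have "E1 \<subseteq> {..<n} \<times> {..<n}" using r s by (auto simp: E1_def)
    moreover have "s (butlast v) < n" if "v \<in> ?W l" "1 \<le> l" "l \<le> \<delta>" for v l
    proof -
      have "butlast v \<in> ?W (l - 1)" using parent[of v "l - 1"] that by simp
      from s[OF this] that show ?thesis by simp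
    qed
    then have "E2 \<subseteq> {..<n} \<times> {..<n}" using r by (auto simp: E2_def)
    moreover have "E3 \<subseteq> {..<n} \<times> {..<n}" using p s by (fastforce simp: E3_def)
    moreover have "E4 \<subseteq> {..<n} \<times> {..<n}" using q r by (fastforce simp: E4_def)
    ultimately show ?thesis by (simp add: T_def)
  qed
  let ?A = "adj (bichromatic_edges T)"
  have A: "(Inl i, Inr j) \<in> ?A" "(Inr j, Inl i) \<in> ?A" if "(i, j) \<in> T" for i j
    using that by (auto simp: adj_iff)
  have rs: "(r v, s v) \<in> T" if "v \<in> ?W l" "l \<le> \<delta>" for v l
    using that by (auto simp: T_def E1_def)
  \<comment> \<open>From \<open>r v\<close> the walk goes to the blue and then to the red
    representative of the parent, and so on up to the root.\<close>
  have rep: "(Inl (r v), Inl (r [])) \<in> ?A\<^sup>*" if "v \<in> ?W l" "l \<le> \<delta>" for v l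
    using that
  proof (induction l arbitrary: v)
    case 0
    then have "v = []" by (auto simp: bichromatic_nodes_def)
    then show ?case by simp
  next
    case (Suc l)
    have "(r v, s (butlast v)) \<in> T" using Suc.prems by (auto simp: T_def E2_def)
    moreover have "butlast v \<in> ?W l" "l \<le> \<delta>" using parent[OF Suc.prems] Suc.prems by auto
    then have "(r (butlast v), s (butlast v)) \<in> T" "(Inl (r (butlast v)), Inl (r [])) \<in> ?A\<^sup>*"
      using rs Suc.IH by auto
    ultimately show ?case
      by (blast intro: A converse_rtrancl_into_rtrancl)
  qed
  have root: "(u, Inl (r [])) \<in> ?A\<^sup>*" if "u \<in> {..<n} <+> {..<n}" for u
  proof (cases u)
    case (Inl i)
    with that p[rule_format, of i] obtain l where l: "p i \<in> ?W l" "l \<le> \<delta>" by auto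
    have "(i, s (p i)) \<in> T" using that Inl by (auto simp: T_def E3_def)
    with rs[OF l] rep[OF l] show ?thesis unfolding Inl
      by (blast intro: A converse_rtrancl_into_rtrancl)
  next
    case (Inr j)
    with that q[rule_format, of j] obtain l where l: "q j \<in> ?W l" "l \<le> \<delta>" by auto
    have "(r (q j), j) \<in> T" using that Inr by (auto simp: T_def E4_def)
    with rep[OF l] show ?thesis unfolding Inr
      by (blast intro: A converse_rtrancl_into_rtrancl)
  qed
  have conn: "({..<n} <+> {..<n}) \<times> ({..<n} <+> {..<n}) \<subseteq> ?A\<^sup>*"
    using root by (blast intro: rtrancl_trans symD[OF sym_adj_rtrancl])
  define g where "g = (\<lambda>(i, j). ?d (R i) (B j))"
  have g: "g e \<ge> 0" for e using lam by (simp add: g_def case_prod_unfold cut_dist_nonneg)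
  have fin: "finite E1" "finite E2" "finite E3" "finite E4"
    using finite_subset[OF sub] by (auto simp: T_def)
  have "sum g E1 \<le> (\<Sum>l\<le>\<delta>. real (card (?W l)) * (2 * lam ^ Suc l / (1 - lam)))"
    unfolding E1_def
  proof (rule sum_bichromatic_nodes_le[OF _ g])
    fix l v assume "l \<in> {..\<delta>}" "v \<in> ?W l"
    then show "g (r v, s v) \<le> 2 * lam ^ Suc l / (1 - lam)"
      using r[of v l] s[of v l] lam cut_dist_le[of lam l "R (r v)" "B (s v)" \<delta>] by (simp add: g_def)
  qed simp
  also have "\<dots> = real (card (?W 0)) * (2 * lam / (1 - lam)) +
      (\<Sum>l=1..\<delta>. real (card (?W l)) * (2 * lam ^ Suc l / (1 - lam)))"
    by (simp add: atMost_atLeast0 sum.atLeast_Suc_atMost)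
  \<comment> \<open>At level 0 there is only the root, which gives the separate first term.
    Elsewhere \<open>lam ^ Suc l\<close> is weakened to \<open>lam ^ l\<close>, to match the bound
    for \<open>E2\<close>.\<close>
  also have "\<dots> \<le> 2 * lam / (1 - lam) + (\<Sum>l=1..\<delta>. real (card (?W l)) * (2 * lam ^ l / (1 - lam)))"
  proof (rule add_mono)
    have "card (?W 0) \<le> card {[] :: 'a list}"
      by (rule card_mono) (auto simp: bichromatic_nodes_def)
    then show "real (card (?W 0)) * (2 * lam / (1 - lam)) \<le> 2 * lam / (1 - lam)"
      using lam mult_right_mono[of "real (card (?W 0))" 1 "2 * lam / (1 - lam)"] by simp
    show "(\<Sum>l=1..\<delta>. real (card (?W l)) * (2 * lam ^ Suc l / (1 - lam))) \<le>
        (\<Sum>l=1..\<delta>. real (card (?W l)) * (2 * lam ^ l / (1 - lam)))"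
      using lam by (intro sum_mono mult_left_mono divide_right_mono power_decreasing) auto
  qed
  finally have E1: "sum g E1 \<le> 2 * lam / (1 - lam) +
      (\<Sum>l=1..\<delta>. real (card (?W l)) * (2 * lam ^ l / (1 - lam)))" .
  \<comment> \<open>The ends of such an edge are only known to agree up to level
    \<open>l - 1\<close>, so the geometric tail starts at \<open>l\<close>, one level earlier than
    for \<open>E1\<close>.\<close>
  have E2: "sum g E2 \<le> (\<Sum>l=1..\<delta>. real (card (?W l)) * (2 * lam ^ l / (1 - lam)))"
    unfolding E2_def
  proof (rule sum_bichromatic_nodes_le[OF _ g])
    fix l v assume l: "l \<in> {1..\<delta>}" "v \<in> ?W l"
    then obtain m where m: "l = Suc m" by (cases l) auto
    have "butlast v \<in> ?W m" using parent[of v m] l m by simp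
    from s[OF this] have "take m (B (s (butlast v))) = butlast v" using l m by simp
    moreover have "take m (R (r v)) = butlast v"
    proof -
      have "take m (R (r v)) = take m (take l (R (r v)))" using m by simp
      also have "\<dots> = butlast v"
        using r[of v l] l m lenW[of v l] by (simp add: butlast_conv_take)
      finally show ?thesis .
    qed
    ultimately show "g (r v, s (butlast v)) \<le> 2 * lam ^ l / (1 - lam)"
      using cut_dist_le[of lam m "R (r v)" "B (s (butlast v))" \<delta>] lam m by (simp add: g_def)
  qed simp
  have E3: "sum g E3 \<le> (\<Sum>k=1..\<delta>. 2 * lam ^ k * real (card (isolated_points n R B k)))"
  proof -
    have "sum g E3 \<le> (\<Sum>i<n. ?d (R i) (B (s (p i))))"
      using sum_image_le[of "{..<n}" g "\<lambda>i. (i, s (p i))"] lam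
      by (simp add: E3_def g_def cut_dist_nonneg)
    also have "\<dots> \<le> (\<Sum>k=1..\<delta>. 2 * lam ^ k * real (card (isolated_points n R B k)))"
    proof (rule p_cost[rule_format])
      fix i assume "i < n"
      with p obtain l where l: "p i \<in> ?W l" "l \<le> \<delta>" by blast
      then show "take (length (p i)) (B (s (p i))) = p i" using s[OF l] lenW[OF l] by simp
    qed
    finally show ?thesis .
  qed
  have E4: "sum g E4 \<le> (\<Sum>k=1..\<delta>. 2 * lam ^ k * real (card (isolated_points n B R k)))"
  proof -
    have "sum g E4 \<le> (\<Sum>i<n. ?d (B i) (R (r (q i))))"
      using sum_image_le[of "{..<n}" g "\<lambda>i. (r (q i), i)"] lam
      by (simp add: E4_def g_def cut_dist_nonneg cut_dist_commute[of _ _ "B _"])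
    also have "\<dots> \<le> (\<Sum>k=1..\<delta>. 2 * lam ^ k * real (card (isolated_points n B R k)))"
    proof (rule q_cost[rule_format])
      fix i assume "i < n"
      with q obtain l where l: "q i \<in> ?W l" "l \<le> \<delta>" by blast
      then show "take (length (q i)) (R (r (q i))) = q i" using r[OF l] lenW[OF l] by simp
    qed
    finally show ?thesis .
  qed
  have "bichromatic_mst_cost ?d n R B \<le> sum g T"
    unfolding g_def using n sub conn lam by (intro bichromatic_mst_cost_le) (auto simp: cut_dist_nonneg)
  also have "\<dots> \<le> sum g E1 + sum g E2 + (sum g E3 + sum g E4)"
    unfolding T_def using fin g
    by (intro order_trans[OF sum_Un_le] add_mono sum_Un_le) auto
  also have "\<dots> \<le> 2 * lam / (1 - lam) +
      ((\<Sum>l=1..\<delta>. real (card (?W l)) * (2 * lam ^ l / (1 - lam))) +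
       (\<Sum>l=1..\<delta>. real (card (?W l)) * (2 * lam ^ l / (1 - lam)))) +
      (\<Sum>l=1..\<delta>. 2 * lam ^ l * real (card (isolated_points n R B l))) +
      (\<Sum>l=1..\<delta>. 2 * lam ^ l * real (card (isolated_points n B R l)))"
    using E1 E2 E3 E4 by linarith
  also have "(\<Sum>l=1..\<delta>. real (card (?W l)) * (2 * lam ^ l / (1 - lam))) +
       (\<Sum>l=1..\<delta>. real (card (?W l)) * (2 * lam ^ l / (1 - lam))) =
      (\<Sum>l=1..\<delta>. 4 / (1 - lam) * lam ^ l * real (card (?W l)))"
    unfolding sum.distrib[symmetric] by (intro sum.cong) (auto simp: field_simps)
  finally show ?thesis .
qed

section \<open>Expectations\<close>

lemma finite_hst_leaves [simp]: "finite (hst_leaves b \<delta>)"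
  using finite_lists_length_eq[of "{..<b}" \<delta>] by (simp add: hst_leaves_def)

lemma card_hst_leaves: "card (hst_leaves b \<delta>) = b ^ \<delta>"
  using card_lists_length_eq[of "{..<b}" \<delta>] by (simp add: hst_leaves_def)

lemma hst_leaves_nonempty: "b > 0 \<Longrightarrow> hst_leaves b \<delta> \<noteq> {}"
  using card_hst_leaves[of b \<delta>] by auto

lemma take_hst_leaf: "x \<in> hst_leaves b \<delta> \<Longrightarrow> l \<le> \<delta> \<Longrightarrow> take l x \<in> hst_leaves b l"
  by (auto simp: hst_leaves_def dest: in_set_takeD)

text \<open>The part of a leaf after \<open>v\<close> is a leaf of the tree of depth
  \<open>\<delta> - l\<close>.\<close>

lemma card_hst_leaves_below:
  assumes "v \<in> hst_leaves b l" "l \<le> \<delta>"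
  shows "card (hst_leaves b \<delta> \<inter> {x. take l x = v}) = b ^ (\<delta> - l)"
proof -
  have "hst_leaves b \<delta> \<inter> {x. take l x = v} = (\<lambda>w. v @ w) ` hst_leaves b (\<delta> - l)"
  proof (intro equalityI subsetI)
    fix x assume x: "x \<in> hst_leaves b \<delta> \<inter> {x. take l x = v}"
    then have "x = v @ drop l x" by auto
    moreover have "drop l x \<in> hst_leaves b (\<delta> - l)"
      using x by (auto simp: hst_leaves_def dest: in_set_dropD)
    ultimately show "x \<in> (\<lambda>w. v @ w) ` hst_leaves b (\<delta> - l)" by blast
  qed (use assms in \<open>auto simp: hst_leaves_def\<close>)
  then show ?thesis by (simp add: card_image card_hst_leaves inj_on_def)
qed

lemma prob_leaf_not_below:
  assumes "b > 0" "v \<in> hst_leaves b l" "l \<le> \<delta>"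
  shows "measure_pmf.prob (pmf_of_set (hst_leaves b \<delta>)) {x. take l x \<noteq> v} = 1 - 1 / real b ^ l"
proof -
  let ?U = "pmf_of_set (hst_leaves b \<delta>)"
  have "measure_pmf.prob ?U {x. take l x = v} = real (b ^ (\<delta> - l)) / real (b ^ \<delta>)"
    using assms card_hst_leaves_below[OF assms(2,3)]
    by (simp add: measure_pmf_of_set hst_leaves_nonempty card_hst_leaves)
  also have "\<dots> = 1 / real b ^ l"
    using assms(1) power_add[of "real b" l "\<delta> - l"] assms(3) by simp
  finally have "measure_pmf.prob ?U {x. take l x = v} = 1 / real b ^ l" .
  moreover have "{x. take l x \<noteq> v} = UNIV - {x. take l x = v}" by auto
  ultimately show ?thesis
    using measure_pmf.prob_compl[of "{x. take l x = v}" ?U] by simp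
qed

lemma random_submultiset_mem:
  assumes "b > 0" "R \<in> set_pmf (random_submultiset b \<delta> n)" "i < n"
  shows "R i \<in> hst_leaves b \<delta>"
  using assms
  by (auto simp: random_submultiset_def set_Pi_pmf PiE_dflt_def hst_leaves_nonempty)

lemma finite_random_submultiset [simp]:
  "b > 0 \<Longrightarrow> finite (set_pmf (random_submultiset b \<delta> n))"
  by (auto simp: random_submultiset_def set_Pi_pmf hst_leaves_nonempty intro!: finite_PiE_dflt)

text \<open>The event is a product of equal events, one per coordinate, so independence yields a
  power.\<close>

lemma prob_random_submultiset_avoids:
  assumes "b > 0" "v \<in> hst_leaves b l" "l \<le> \<delta>"
  shows "measure_pmf.prob (random_submultiset b \<delta> n) {f. \<forall>i<n. take l (f i) \<noteq> v} =
    (1 - 1 / real b ^ l) ^ n"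
proof -
  have "{f. \<forall>i<n. take l (f i) \<noteq> v} = Pi {..<n} (\<lambda>_. {x. take l x \<noteq> v})" by auto
  then show ?thesis
    by (simp add: random_submultiset_def measure_Pi_pmf_Pi prob_leaf_not_below[OF assms])
qed

lemma expectation_of_bool:
  "measure_pmf.expectation p (\<lambda>x. of_bool (P x)) = measure_pmf.prob p {x. P x}"
proof -
  have "(\<lambda>x. of_bool (P x) :: real) = indicator {x. P x}" by (auto simp: indicator_def)
  then show ?thesis by simp
qed

lemma expectation_mono:
  fixes f g :: "'a \<Rightarrow> real"
  assumes "finite (set_pmf p)" "\<And>x. x \<in> set_pmf p \<Longrightarrow> f x \<le> g x"
  shows "measure_pmf.expectation p f \<le> measure_pmf.expectation p g"
  using assms by (intro integral_mono_AE integrable_measure_pmf_finite) (auto simp: AE_measure_pmf_iff)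

text \<open>Conditioning on the first component, which allows one colour to be fixed while the other
  is random.\<close>

lemma expectation_pair_pmf_le:
  fixes f :: "'a \<times> 'b \<Rightarrow> real"
  assumes "finite (set_pmf p)" "finite (set_pmf q)"
    and "\<And>x. x \<in> set_pmf p \<Longrightarrow> measure_pmf.expectation q (\<lambda>y. f (x, y)) \<le> c"
  shows "measure_pmf.expectation (pair_pmf p q) f \<le> c"
proof -
  have "pair_pmf p q = p \<bind> (\<lambda>x. map_pmf (Pair x) q)"
    by (simp add: pair_pmf_def map_pmf_def)
  then have "measure_pmf.expectation (pair_pmf p q) f =
      (\<Sum>x\<in>set_pmf p. pmf p x *\<^sub>R measure_pmf.expectation (map_pmf (Pair x) q) f)"
    using assms by (simp only:) (intro pmf_expectation_bind, auto)
  also have "\<dots> \<le> (\<Sum>x\<in>set_pmf p. pmf p x * c)"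
    using assms by (auto intro!: sum_mono mult_left_mono)
  also have "\<dots> = c"
    using assms(1) by (simp add: sum_pmf_eq_1 flip: sum_distrib_right)
  finally show ?thesis .
qed

section \<open>Expected numbers of isolated points and occupied nodes\<close>

lemma one_minus_inverse_power_le:
  assumes "x \<ge> (1::real)"
  shows "(1 - 1 / x) ^ n \<le> exp (- (real n / x))"
proof -
  have "1 - 1 / x \<le> exp (- (1 / x))" using exp_ge_add_one_self[of "- (1 / x)"] by simp
  then have "(1 - 1 / x) ^ n \<le> exp (- (1 / x)) ^ n"
    using assms by (intro power_mono) auto
  also have "\<dots> = exp (- (real n / x))" by (simp flip: exp_of_nat_mult)
  finally show ?thesis .
qed

text \<open>With \<open>t = n / x\<close> the left-hand side is at most
  \<open>x * t * exp (- t)\<close>, and \<open>t \<le> exp t\<close> gives the bound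
  \<open>x\<close>. The bound \<open>n\<close> holds because the power is at most 1.\<close>

lemma mult_one_minus_inverse_power_le:
  assumes "x \<ge> (1::real)"
  shows "real n * (1 - 1 / x) ^ n \<le> min x (real n)"
proof (rule min.boundedI)
  have "real n * (1 - 1 / x) ^ n \<le> real n * exp (- (real n / x))"
    by (intro mult_left_mono one_minus_inverse_power_le assms) simp
  also have "\<dots> = x * (real n / x) * exp (- (real n / x))" using assms by simp
  also have "\<dots> \<le> x * exp (real n / x) * exp (- (real n / x))"
  proof (intro mult_right_mono mult_left_mono)
    show "real n / x \<le> exp (real n / x)" using exp_ge_add_one_self[of "real n / x"] by linarith
  qed (use assms in auto)
  also have "\<dots> = x" by (simp add: exp_minus)
  finally show "real n * (1 - 1 / x) ^ n \<le> x" .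
  have "(1 - 1 / x) ^ n \<le> 1" using assms by (intro power_le_one) auto
  then show "real n * (1 - 1 / x) ^ n \<le> real n" by (simp add: mult_left_le)
qed

text \<open>By linearity: the point \<open>R i\<close> is isolated when all \<open>n\<close> random
  points avoid its ancestor at level \<open>l\<close>.\<close>

lemma expected_isolated_points_le:
  assumes "b > 0" "l \<le> \<delta>" "\<And>i. i < n \<Longrightarrow> R i \<in> hst_leaves b \<delta>"
  shows "measure_pmf.expectation (random_submultiset b \<delta> n) (\<lambda>B. real (card (isolated_points n R B l)))
    \<le> min (real b ^ l) (real n)"
proof -
  let ?Q = "random_submultiset b \<delta> n"
  have "real (card (isolated_points n R B l)) = (\<Sum>i<n. of_bool (\<forall>j<n. take l (B j) \<noteq> take l (R i)))" for B
  proof -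
    have "isolated_points n R B l = {i\<in>{..<n}. \<forall>j<n. take l (B j) \<noteq> take l (R i)}"
      by (auto simp: isolated_points_def image_iff) (metis lessThan_iff)
    then have "real (card (isolated_points n R B l)) = (\<Sum>i\<in>{i\<in>{..<n}. \<forall>j<n. take l (B j) \<noteq> take l (R i)}. 1)"
      by simp
    then show ?thesis unfolding sum.inter_filter[OF finite_lessThan]
      by (simp only: of_bool_def)
  qed
  then have "measure_pmf.expectation ?Q (\<lambda>B. real (card (isolated_points n R B l))) =
      (\<Sum>i<n. measure_pmf.prob ?Q {B. \<forall>j<n. take l (B j) \<noteq> take l (R i)})"
    using assms(1)
    by (simp only: expectation_of_bool[symmetric])
      (intro Bochner_Integration.integral_sum integrable_measure_pmf_finite finite_random_submultiset)
  also have "\<dots> = (\<Sum>i<n. (1 - 1 / real b ^ l) ^ n)"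
    using assms by (intro sum.cong refl prob_random_submultiset_avoids take_hst_leaf) auto
  also have "\<dots> \<le> min (real b ^ l) (real n)"
    using assms(1) mult_one_minus_inverse_power_le[of "real b ^ l" n] by simp
  finally show ?thesis .
qed

text \<open>Since \<open>b ^ l \<le> n\<close>, each of the \<open>b ^ l\<close> nodes is missed by
  all points with probability at most \<open>exp (- 1)\<close>. Any constant above 1/2 would serve:
  two nodes must still leave a positive amount after 1 is subtracted.\<close>

lemma expected_occupied_nodes_ge:
  assumes "b > 0" "l \<le> \<delta>" "b ^ l \<le> n"
  shows "measure_pmf.expectation (random_submultiset b \<delta> n)
    (\<lambda>R. real (card ((\<lambda>i. take l (R i)) ` {..<n}))) \<ge> 3 / 5 * real b ^ l"
proof -
  let ?Q = "random_submultiset b \<delta> n" and ?N = "\<lambda>R. (\<lambda>i. take l (R i)) ` {..<n}"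
  have N: "real (card (?N R)) = (\<Sum>v\<in>hst_leaves b l. 1 - of_bool (\<forall>i<n. take l (R i) \<noteq> v))"
    if "R \<in> set_pmf ?Q" for R
  proof -
    have "?N R = {v\<in>hst_leaves b l. v \<in> ?N R}"
      using random_submultiset_mem[OF assms(1) that] take_hst_leaf assms(2) by blast
    then have "real (card (?N R)) = (\<Sum>v\<in>{v\<in>hst_leaves b l. v \<in> ?N R}. 1)" by simp
    also have "\<dots> = (\<Sum>v\<in>hst_leaves b l. 1 - of_bool (\<forall>i<n. take l (R i) \<noteq> v))"
      unfolding sum.inter_filter[OF finite_hst_leaves] by (rule sum.cong) auto
    finally show ?thesis .
  qed
  \<comment> \<open>The first three terms of the exponential series give 5/2; hence the constant 3/5
    = 1 - 2/5.\<close>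
  have "exp (1::real) \<ge> 5 / 2" using exp_lower_Taylor_quadratic[of "1::real"] by simp
  then have e: "exp (- 1 :: real) \<le> 2 / 5" by (simp add: exp_minus inverse_eq_divide field_simps)
  have "(1 - 1 / real b ^ l) ^ n \<le> exp (- (real n / real b ^ l))"
    using assms(1) by (intro one_minus_inverse_power_le) simp
  also have "\<dots> \<le> exp (- 1)"
    using assms by (simp add: pos_le_divide_eq flip: of_nat_power)
  finally have p: "(1 - 1 / real b ^ l) ^ n \<le> 2 / 5" using e by linarith
  have "3 / 5 * real b ^ l \<le> (\<Sum>v\<in>hst_leaves b l. 1 - (1 - 1 / real b ^ l) ^ n)"
    using p mult_left_mono[of "3 / 5" "1 - (1 - 1 / real b ^ l) ^ n" "real b ^ l"]
    by (simp add: card_hst_leaves mult.commute)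
  also have "\<dots> = (\<Sum>v\<in>hst_leaves b l. 1 - measure_pmf.prob ?Q {R. \<forall>i<n. take l (R i) \<noteq> v})"
    using assms by (intro sum.cong) (auto simp: prob_random_submultiset_avoids)
  also have "\<dots> = measure_pmf.expectation ?Q
      (\<lambda>R. \<Sum>v\<in>hst_leaves b l. 1 - of_bool (\<forall>i<n. take l (R i) \<noteq> v))"
    using assms(1) by (simp add: integrable_measure_pmf_finite expectation_of_bool)
  also have "\<dots> = measure_pmf.expectation ?Q (\<lambda>R. real (card (?N R)))"
    using N by (intro integral_cong_AE) (auto simp: AE_measure_pmf_iff)
  finally show ?thesis .
qed

lemma card_bichromatic_nodes_le:
  assumes "l \<le> \<delta>" "\<And>i. i < n \<Longrightarrow> R i \<in> hst_leaves b \<delta>"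
  shows "real (card (bichromatic_nodes n R B l)) \<le> min (real b ^ l) (real n)"
proof -
  have "card (bichromatic_nodes n R B l) \<le> card (hst_leaves b l)"
    using assms by (intro card_mono) (auto simp: bichromatic_nodes_def intro: take_hst_leaf)
  moreover have "card (bichromatic_nodes n R B l) \<le> card ((\<lambda>i. take l (R i)) ` {..<n})"
    by (intro card_mono) (auto simp: bichromatic_nodes_def)
  then have "card (bichromatic_nodes n R B l) \<le> n"
    using card_image_le[of "{..<n}" "\<lambda>i. take l (R i)"] by simp
  ultimately show ?thesis by (simp add: card_hst_leaves flip: of_nat_power)
qed

section \<open>Bounds on the expected cost\<close>

text \<open>The bound for given points involves only the red ones, so its expectation is taken over
  one component. Levels outside \<open>I\<close> may be dropped, because at least one node is
  occupied at every level.\<close>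

lemma expected_cost_ge:
  assumes "b \<ge> 2" "n > 0" "lam > 0" and I: "I \<subseteq> {1..\<delta>}" "\<And>l. l \<in> I \<Longrightarrow> b ^ l \<le> n"
  shows "expected_bichromatic_mst_cost b \<delta> lam n \<ge> 1 / 10 * (\<Sum>l\<in>I. (real b * lam) ^ l)"
proof -
  have b: "b > 0" using assms(1) by simp
  let ?Q = "random_submultiset b \<delta> n"
  let ?N = "\<lambda>l R. real (card ((\<lambda>i. take l (R i)) ` {..<n}))"
  let ?f = "\<lambda>R. \<Sum>l=1..\<delta>. lam ^ l * (?N l R - 1)"
  have "1 / 10 * (real b * lam) ^ l \<le> lam ^ l * (measure_pmf.expectation ?Q (?N l) - 1)" if "l \<in> I" for l
  proof -
    have l: "1 \<le> l" "l \<le> \<delta>" "b ^ l \<le> n" using that I by auto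
    have "real b \<le> real b ^ l" using l(1) b by (intro self_le_power) auto
    then have "2 \<le> real b ^ l" using assms(1) by linarith
    moreover have "3 / 5 * real b ^ l \<le> measure_pmf.expectation ?Q (?N l)"
      using expected_occupied_nodes_ge[OF b l(2,3)] .
    \<comment> \<open>The constant 1/10 arises here: \<open>3/5 * x - 1 \<ge> x / 10\<close> holds
      exactly for \<open>x \<ge> 2\<close>.\<close>
    ultimately have "1 / 10 * real b ^ l \<le> measure_pmf.expectation ?Q (?N l) - 1" by linarith
    then have "lam ^ l * (1 / 10 * real b ^ l) \<le> lam ^ l * (measure_pmf.expectation ?Q (?N l) - 1)"
      using assms(3) by (intro mult_left_mono) auto
    then show ?thesis by (simp add: power_mult_distrib mult_ac)
  qed
  then have "1 / 10 * (\<Sum>l\<in>I. (real b * lam) ^ l) \<le>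
      (\<Sum>l\<in>I. lam ^ l * (measure_pmf.expectation ?Q (?N l) - 1))"
    unfolding sum_distrib_left by (intro sum_mono)
  also have "\<dots> \<le> (\<Sum>l=1..\<delta>. lam ^ l * (measure_pmf.expectation ?Q (?N l) - 1))"
  proof (rule sum_mono2[OF _ I(1)])
    fix l
    have "1 \<le> ?N l R" for R :: "nat \<Rightarrow> nat list"
    proof -
      have "(\<lambda>i. take l (R i)) ` {..<n} \<noteq> {}" using assms(2) by auto
      then show ?thesis by (simp add: Suc_le_eq card_gt_0_iff)
    qed
    then have "measure_pmf.expectation ?Q (\<lambda>_. 1) \<le> measure_pmf.expectation ?Q (?N l)"
      using b by (intro expectation_mono) auto
    then show "0 \<le> lam ^ l * (measure_pmf.expectation ?Q (?N l) - 1)" using assms(3) by simp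
  qed simp
  also have "\<dots> = measure_pmf.expectation ?Q ?f"
    using b by (simp add: integrable_measure_pmf_finite)
  also have "\<dots> = measure_pmf.expectation (pair_pmf ?Q ?Q) (\<lambda>x. ?f (fst x))"
    by (rule expectation_pair_pmf_fst[symmetric])
  also have "\<dots> \<le> expected_bichromatic_mst_cost b \<delta> lam n"
    unfolding expected_bichromatic_mst_cost_def
  proof (rule expectation_mono)
    fix x assume "x \<in> set_pmf (pair_pmf ?Q ?Q)"
    then obtain R B where x: "x = (R, B)" "R \<in> set_pmf ?Q" "B \<in> set_pmf ?Q" by auto
    have "bichromatic_mst_cost (hst_dist b \<delta> lam) n R B = bichromatic_mst_cost (cut_dist \<delta> lam) n R B"
      using x b by (intro bichromatic_mst_cost_cong hst_dist_eq_cut_dist[of _ b]) 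
        (auto dest: random_submultiset_mem)
    then show "?f (fst x) \<le> (case x of (R, B) \<Rightarrow> bichromatic_mst_cost (hst_dist b \<delta> lam) n R B)"
      using bichromatic_mst_cost_cut_dist_ge[OF assms(2,3)] x(1) by simp
  qed (use b in simp)
  finally show ?thesis .
qed

text \<open>The number of bichromatic nodes is bounded for all outcomes, that of isolated points
  only in expectation; at each level both have the bound \<open>min (b ^ l) n\<close>.\<close>

lemma expected_cost_le:
  assumes "b > 0" "n > 0" "0 < lam" "lam < 1"
  shows "expected_bichromatic_mst_cost b \<delta> lam n \<le> 2 * lam / (1 - lam) +
    (4 / (1 - lam) + 4) * (\<Sum>l=1..\<delta>. lam ^ l * min (real b ^ l) (real n))"
proof -
  let ?Q = "random_submultiset b \<delta> n"
  let ?M = "\<lambda>l. min (real b ^ l) (real n)"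
  let ?E = "measure_pmf.expectation (pair_pmf ?Q ?Q)"
  let ?g1 = "\<lambda>x. \<Sum>l=1..\<delta>. 2 * lam ^ l * real (card (isolated_points n (fst x) (snd x) l))"
  let ?g2 = "\<lambda>x. \<Sum>l=1..\<delta>. 2 * lam ^ l * real (card (isolated_points n (snd x) (fst x) l))"
  define K where "K = 2 * lam / (1 - lam) + (\<Sum>l=1..\<delta>. 4 / (1 - lam) * lam ^ l * ?M l)"
  have int: "integrable (pair_pmf ?Q ?Q) f" for f :: "_ \<Rightarrow> real"
    using assms(1) by (intro integrable_measure_pmf_finite) simp
  have "expected_bichromatic_mst_cost b \<delta> lam n \<le> ?E (\<lambda>x. K + ?g1 x + ?g2 x)"
    unfolding expected_bichromatic_mst_cost_def
  proof (rule expectation_mono)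
    fix x assume "x \<in> set_pmf (pair_pmf ?Q ?Q)"
    then obtain R B where x: "x = (R, B)" "R \<in> set_pmf ?Q" "B \<in> set_pmf ?Q" by auto
    have R: "R i \<in> hst_leaves b \<delta>" and B: "B i \<in> hst_leaves b \<delta>" if "i < n" for i
      using x assms(1) that by (auto dest: random_submultiset_mem)
    have "bichromatic_mst_cost (hst_dist b \<delta> lam) n R B = bichromatic_mst_cost (cut_dist \<delta> lam) n R B"
      using R B by (intro bichromatic_mst_cost_cong hst_dist_eq_cut_dist[of _ b])
    also have "\<dots> \<le> 2 * lam / (1 - lam) +
      (\<Sum>l=1..\<delta>. 4 / (1 - lam) * lam ^ l * real (card (bichromatic_nodes n R B l))) + ?g1 x + ?g2 x"
      unfolding x(1) fst_conv snd_conv using R B assms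
      by (intro bichromatic_mst_cost_cut_dist_le) (auto simp: hst_leaves_def)
    also have "\<dots> \<le> K + ?g1 x + ?g2 x"
      unfolding K_def using assms R
      by (intro add_mono order_refl sum_mono mult_left_mono card_bichromatic_nodes_le[of _ \<delta>]) auto
    finally show "(case x of (R, B) \<Rightarrow> bichromatic_mst_cost (hst_dist b \<delta> lam) n R B) \<le> K + ?g1 x + ?g2 x"
      using x(1) by simp
  qed (use assms(1) in simp)
  also have "\<dots> = K + ?E ?g1 + ?E ?g2"
    by (simp add: int)
  \<comment> \<open>Red and blue have the same distribution, so exchanging the components changes
    nothing.\<close>
  also have "?E ?g2 = ?E ?g1"
    by (subst pair_commute_pmf) (simp add: case_prod_unfold)
  also have "?E ?g1 \<le> (\<Sum>l=1..\<delta>. 2 * lam ^ l * ?M l)"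
  proof (rule expectation_pair_pmf_le)
    fix R assume R: "R \<in> set_pmf ?Q"
    have "measure_pmf.expectation ?Q (\<lambda>B. ?g1 (R, B)) =
        (\<Sum>l=1..\<delta>. 2 * lam ^ l * measure_pmf.expectation ?Q (\<lambda>B. real (card (isolated_points n R B l))))"
      using assms(1) by (simp add: integrable_measure_pmf_finite)
    also have "\<dots> \<le> (\<Sum>l=1..\<delta>. 2 * lam ^ l * ?M l)"
      using assms random_submultiset_mem[OF assms(1) R]
      by (intro sum_mono mult_left_mono expected_isolated_points_le) auto
    finally show "measure_pmf.expectation ?Q (\<lambda>B. ?g1 (R, B)) \<le> (\<Sum>l=1..\<delta>. 2 * lam ^ l * ?M l)" .
  qed (use assms(1) in simp_all)
  finally have "expected_bichromatic_mst_cost b \<delta> lam n \<le>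
      K + (\<Sum>l=1..\<delta>. 2 * lam ^ l * ?M l) + (\<Sum>l=1..\<delta>. 2 * lam ^ l * ?M l)" by simp
  \<comment> \<open>The factor \<open>4 / (1 - lam)\<close> comes from the bichromatic nodes, and 4
    = 2 + 2 from the isolated points of the two colours.\<close>
  also have "\<dots> = 2 * lam / (1 - lam) + (4 / (1 - lam) + 4) * (\<Sum>l=1..\<delta>. lam ^ l * ?M l)"
    unfolding K_def by (simp add: distrib_right sum_distrib_left mult.assoc add.commute flip: sum.distrib)
  finally show ?thesis .
qed

text \<open>It is applied with \<open>m\<close> the last level up to \<delta> for which
  \<open>b ^ m \<le> n\<close>. Beyond \<open>m\<close> the minimum is at most
  \<open>b ^ Suc m\<close>, so these levels form a geometric tail bounded by
  \<open>b * lam / (1 - lam)\<close> times \<open>(b * lam) ^ m\<close>, which is the last term of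
  the sum on the right.\<close>

lemma truncated_sum_le:
  fixes b n \<delta> :: nat
  assumes "b > 0" "0 < lam" "lam < 1" and m: "1 \<le> m" "m \<le> \<delta>" "m < \<delta> \<Longrightarrow> n < b ^ Suc m"
  shows "(\<Sum>l=1..\<delta>. lam ^ l * min (real b ^ l) (real n)) \<le>
    (1 + real b * lam / (1 - lam)) * (\<Sum>l=1..m. (real b * lam) ^ l)"
proof -
  let ?S = "\<Sum>l=1..m. (real b * lam) ^ l"
  have "(\<Sum>l=1..\<delta>. lam ^ l * min (real b ^ l) (real n)) =
      (\<Sum>l=1..m. lam ^ l * min (real b ^ l) (real n)) + (\<Sum>l=Suc m..\<delta>. lam ^ l * min (real b ^ l) (real n))"
    using m sum.ub_add_nat[of 1 m _ "\<delta> - m"] by simp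
  also have "(\<Sum>l=1..m. lam ^ l * min (real b ^ l) (real n)) \<le> ?S"
    unfolding power_mult_distrib mult.commute[of "real b ^ _"]
    using assms(2) by (intro sum_mono mult_left_mono) auto
  also have "(\<Sum>l=Suc m..\<delta>. lam ^ l * min (real b ^ l) (real n)) \<le> real b * lam / (1 - lam) * ?S"
  proof (cases "m < \<delta>")
    case True
    have "(\<Sum>l=Suc m..\<delta>. lam ^ l * min (real b ^ l) (real n)) \<le> (\<Sum>l=Suc m..\<delta>. lam ^ l * real b ^ Suc m)"
      using assms(2) m(3)[OF True] by (intro sum_mono mult_left_mono min.coboundedI2) (auto simp flip: of_nat_power of_nat_mult)
    also have "\<dots> \<le> lam ^ Suc m / (1 - lam) * real b ^ Suc m"
      unfolding sum_distrib_right[symmetric] using assms by (intro mult_right_mono power_tail_le) auto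
    also have "\<dots> = real b * lam / (1 - lam) * (real b * lam) ^ m"
      by (simp add: power_mult_distrib mult_ac)
    also have "\<dots> \<le> real b * lam / (1 - lam) * ?S"
      using assms by (intro mult_left_mono member_le_sum) auto
    finally show ?thesis .
  qed (use assms in \<open>simp add: sum_nonneg\<close>)
  finally show ?thesis by (simp add: distrib_right)
qed

text \<open>The condition \<open>n \<ge> b\<close> puts level 1 into the sum; for
  \<open>1 \<le> n < b\<close> the sum would be empty although the expected cost is
  positive.\<close>

theorem theorem8:
  fixes b :: nat and lam :: real
  assumes "b \<ge> 2" and "0 < lam" and "lam < 1"
  shows "\<exists>c C :: real. c > 0 \<and> C > 0 \<and>
    (\<forall>(\<delta>::nat) (n::nat). \<delta> \<ge> 1 \<longrightarrow> n \<ge> b \<longrightarrow>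
      (let h = min (real \<delta>) (log (real b) (real n));
           S = (\<Sum>i\<in>{i::nat. 1 \<le> i \<and> real i \<le> h}. (real b * lam) ^ i)
       in c * S \<le> expected_bichromatic_mst_cost b \<delta> lam n \<and>
          expected_bichromatic_mst_cost b \<delta> lam n \<le> C * S))"
proof -
  define K where "K = 4 / (1 - lam) + 4"
  define L where "L = 1 + real b * lam / (1 - lam)"
  \<comment> \<open>The first summand absorbs the cost at the root, the second the costs of all
    levels up to \<delta>.\<close>
  define C where "C = 2 / (1 - lam) + K * L"
  have "K > 0" "L > 0" using assms by (auto simp: K_def L_def intro!: add_pos_nonneg)
  then have "C > 0" using assms by (simp add: C_def add_pos_pos)
  moreover have "1 / 10 * S \<le> expected_bichromatic_mst_cost b \<delta> lam n \<and>
      expected_bichromatic_mst_cost b \<delta> lam n \<le> C * S"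
    if "\<delta> \<ge> 1" "n \<ge> b" "h = min (real \<delta>) (log (real b) (real n))"
      and S: "S = (\<Sum>i\<in>{i::nat. 1 \<le> i \<and> real i \<le> h}. (real b * lam) ^ i)" for \<delta> n h S
  proof -
    have n: "n > 0" "b > 0" using assms(1) that(2) by auto
    have log: "real i \<le> log (real b) (real n) \<longleftrightarrow> b ^ i \<le> n" for i
      using n assms(1) by (simp add: le_log_iff powr_realpow flip: of_nat_power)
    define P where "P i \<longleftrightarrow> i \<le> \<delta> \<and> b ^ i \<le> n" for i
    \<comment> \<open>This is the integer part of \<open>h\<close>: the summation range turns out to
      be \<open>{1..m}\<close>.\<close>
    define m where "m = Greatest P"
    have "P 1" using that by (simp add: P_def)
    then have "P m" unfolding m_def by (rule GreatestI_nat[where b = \<delta>]) (auto simp: P_def)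
    have max: "i \<le> m" if "P i" for i
      using that unfolding m_def by (rule Greatest_le_nat[where b = \<delta>]) (auto simp: P_def)
    have below: "P i" if "i \<le> m" for i
      using that \<open>P m\<close> n power_increasing[of i m b] by (auto simp: P_def)
    have "real i \<le> h \<longleftrightarrow> P i" for i by (simp add: that(3) P_def log)
    moreover have "P i \<longleftrightarrow> i \<le> m" for i using max below by blast
    ultimately have "{i. 1 \<le> i \<and> real i \<le> h} = {1..m}" by auto
    then have S': "S = (\<Sum>l=1..m. (real b * lam) ^ l)" by (simp add: S)
    have m: "1 \<le> m" "m \<le> \<delta>" using max[OF \<open>P 1\<close>] \<open>P m\<close> by (auto simp: P_def)
    have "n < b ^ Suc m" if "m < \<delta>"
      using max[of "Suc m"] that by (cases "b ^ Suc m \<le> n") (simp_all add: P_def)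
    note sum_le = truncated_sum_le[OF n(2) assms(2,3) m this]
    \<comment> \<open>The term of level 1 dominates \<open>lam\<close>, so a multiple of
      \<open>S\<close> covers the root term, which does not depend on \<open>n\<close> or
      \<delta>.\<close>
    have "lam \<le> (real b * lam) ^ 1" using assms by simp
    also have "\<dots> \<le> S" unfolding S' using m assms by (intro member_le_sum) auto
    finally have lam_S: "lam \<le> S" .
    have "1 / 10 * S \<le> expected_bichromatic_mst_cost b \<delta> lam n"
      unfolding S' using n assms below m by (intro expected_cost_ge) (auto simp: P_def)
    moreover have "expected_bichromatic_mst_cost b \<delta> lam n \<le> 2 * lam / (1 - lam) +
        K * (\<Sum>l=1..\<delta>. lam ^ l * min (real b ^ l) (real n))"
      unfolding K_def by (rule expected_cost_le[OF n(2,1) assms(2,3)])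
    moreover have "2 * lam / (1 - lam) \<le> 2 / (1 - lam) * S"
      using lam_S assms(3) by (simp add: divide_right_mono)
    moreover have "K * (\<Sum>l=1..\<delta>. lam ^ l * min (real b ^ l) (real n)) \<le> K * (L * S)"
      unfolding L_def S' using sum_le \<open>K > 0\<close> by (intro mult_left_mono) auto
    ultimately show ?thesis by (simp add: C_def distrib_right mult.assoc)
  qed
  ultimately show ?thesis
    by (intro exI[of _ "1 / 10"] exI[of _ C]) (simp add: Let_def)
qed

end
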